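(* Let $m\ge 2$ and consider the billiard on the torus $\mathbb{T}^m=\mathbb{R}^m/\mathbb{Z}^m$ with one small obstacle $O$. If $\mathbf{u}$ is a vector from the interior of the admissible rotation set $AR$, then there exists a trajectory of admissible type with rotation vector $\mathbf{u}$.
   Context: Setting: the obstacle $O$ on $\mathbb{T}^m$ lifts to a family of pairwise disjoint sets $O_{\mathbf{k}}=O_{\mathbf{0}}+\mathbf{k}$, $\mathbf{k}\in\mathbb{Z}^m$, in $\mathbb{R}^m$, where $O_{\mathbf{0}}$ is compact, has nonempty interior and smooth boundary, and is strictly convex (convex, with boundary containing no straight line segment). $O$ is small if it is contained in a closed ball of radius smaller than $\sqrt{2}/4$ (the lifting is then chosen so that $O_{\mathbf{k}}$ is contained in such a ball centered at $\mathbf{k}$). Billiard trajectories move with unit speed along straight lines outside the interiors of the obstacles and reflect from obstacle boundaries with angle of incidence equal to angle of reflection; trajectories are lifted to $\mathbb{R}^m$, and the time along a trajectory piece equals its length. A tangency is not counted as a reflection. "Trajectory" means positive (one-sided) trajectory. Admissibility: $O_{\mathbf{k}}$ is between $O_{\mathbf{i}}$ and $O_{\mathbf{j}}$ if $\mathbf{k}\ne\mathbf{i},\mathbf{j}$ and $O_{\mathbf{k}}$ intersects the convex hull of $O_{\mathbf{i}}\cup O_{\mathbf{j}}$. A (finite or infinite) sequence $(\mathbf{k}_n)_{n\ge 0}$ in $\mathbb{Z}^m$ is admissible if (1) $\mathbf{k}_0=\mathbf{0}$; (2) $\mathbf{k}_{n+1}\ne\mathbf{k}_n$ for every $n$; (3)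 for every $n$ there is no obstacle between $O_{\mathbf{k}_n}$ and $O_{\mathbf{k}_{n+1}}$; (4) for every $n$ the obstacle $O_{\mathbf{k}_{n+1}}$ is not between $O_{\mathbf{k}_n}$ and $O_{\mathbf{k}_{n+2}}$. A trajectory starting on the boundary of $O$ has type $(\mathbf{k}_n)_{n=0}^\infty$ if $\mathbf{k}_0=\mathbf{0}$ and its continuous lifting starting on the boundary of $O_{\mathbf{k}_0}$ reflects consecutively from $O_{\mathbf{k}_1},O_{\mathbf{k}_2},\dots$; a trajectory piece in $\mathbb{R}^m$ has type $(\mathbf{k}_n)_{n=0}^s$ if it starts on the boundary of $O_{\mathbf{k}_0}$, reflects consecutively from $O_{\mathbf{k}_1},\dots,O_{\mathbf{k}_{s-1}}$ and ends on the boundary of $O_{\mathbf{k}_s}$ (translating so that $\mathbf{k}_0=\mathbf{0}$). The admissible rotation set $AR$ is the set of all limits of sequences $((\mathbf{y}_n-\mathbf{x}_n)/t_n)_{n=1}^\infty$ such that there is a trajectory piece of admissible type in $\mathbb{R}^m$ from $\mathbf{x}_n$ to $\mathbf{y}_n$ of length $t_n$, and $t_n\to\infty$. The rotation vector of a trajectory $t\mapsto T(t)\in\mathbb{R}^m$ is $\lim_{t\to\infty}(T(t)-T(0))/t$, if it exists. *)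

theory Defs
  imports "HOL-Analysis.Analysis"
begin

section \<open>The obstacle and its lifts\<close>

definition lattice_point :: "int ^ 'm \<Rightarrow> real ^ 'm" where
  "lattice_point k = (\<chi> i. of_int (k $ i))"

text \<open>The argument \<open>S\<close> of the definitions below is always the lift \<open>O\<^sub>0\<close> of the obstacle.\<close>

definition lifted_obstacle :: "(real ^ 'm) set \<Rightarrow> int ^ 'm \<Rightarrow> (real ^ 'm) set" where
  "lifted_obstacle S k = (\<lambda>x. x + lattice_point k) ` S"

text \<open>
  \<open>S\<close> is near \<open>x\<close> the sublevel set of a \<open>C\<^sup>1\<close> function \<open>f\<close> with nonvanishing gradient \<open>g\<close>.
\<close>

definition local_defining_function ::
    "('a::euclidean_space) set \<Rightarrow> 'a \<Rightarrow> 'a set \<Rightarrow> ('a \<Rightarrow> real) \<Rightarrow> ('a \<Rightarrow> 'a) \<Rightarrow> bool" where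
  "local_defining_function S x U f g \<longleftrightarrow>
     open U \<and> x \<in> U \<and>
     (\<forall>y\<in>U. (f has_derivative (\<lambda>h. g y \<bullet> h)) (at y)) \<and>
     continuous_on U g \<and> (\<forall>y\<in>U. g y \<noteq> 0) \<and>
     S \<inter> U = {y \<in> U. f y \<le> 0}"

text \<open>
  ``Smooth'' is read as \<open>C\<^sup>1\<close>, the weakest regularity for which the normal direction is
  continuous; a \<open>C\<^sup>\<infinity>\<close> boundary is in particular smooth in this sense.
\<close>

definition smooth_boundary :: "('a::euclidean_space) set \<Rightarrow> bool" where
  "smooth_boundary S \<longleftrightarrow> (\<forall>x\<in>frontier S. \<exists>U f g. local_defining_function S x U f g)"

definition outer_unit_normal :: "('a::euclidean_space) set \<Rightarrow> 'a \<Rightarrow> 'a \<Rightarrow> bool" where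
  "outer_unit_normal S x \<nu> \<longleftrightarrow>
     x \<in> frontier S \<and> (\<exists>U f g. local_defining_function S x U f g \<and> \<nu> = g x /\<^sub>R norm (g x))"

definition strictly_convex :: "('a::euclidean_space) set \<Rightarrow> bool" where
  "strictly_convex S \<longleftrightarrow>
     convex S \<and> (\<forall>a b. a \<noteq> b \<longrightarrow> \<not> closed_segment a b \<subseteq> frontier S)"

definition obstacle :: "(real ^ 'm) set \<Rightarrow> bool" where
  "obstacle S \<longleftrightarrow>
     compact S \<and> interior S \<noteq> {} \<and> smooth_boundary S \<and> strictly_convex S \<and>
     (\<forall>j k. j \<noteq> k \<longrightarrow> lifted_obstacle S j \<inter> lifted_obstacle S k = {})"

text \<open>
  The centre \<open>c\<close> of the ball is not normalised to the origin: then \<open>O\<^sub>k\<close> lies in the ball of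
  the same radius centred at \<open>c + k\<close>, and \<open>c = 0\<close> is a special case.
\<close>

definition small_obstacle :: "(real ^ 'm) set \<Rightarrow> bool" where
  "small_obstacle S \<longleftrightarrow> (\<exists>c r. r < sqrt 2 / 4 \<and> S \<subseteq> cball c r)"


section \<open>Billiard trajectories in the lift\<close>

definition incoming_velocity :: "(real \<Rightarrow> 'a::euclidean_space) \<Rightarrow> real \<Rightarrow> 'a \<Rightarrow> bool" where
  "incoming_velocity T t v \<longleftrightarrow> (\<exists>\<epsilon>>0. \<forall>s\<in>{0..\<epsilon>}. T (t - s) = T t - s *\<^sub>R v)"

definition outgoing_velocity :: "(real \<Rightarrow> 'a::euclidean_space) \<Rightarrow> real \<Rightarrow> 'a \<Rightarrow> bool" where
  "outgoing_velocity T t v \<longleftrightarrow> (\<exists>\<epsilon>>0. \<forall>s\<in>{0..\<epsilon>}. T (t + s) = T t + s *\<^sub>R v)"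

text \<open>
  A unit-speed billiard path with time domain \<open>I\<close>, which is \<open>{0..L}\<close> or \<open>{0..}\<close> below.
  At a boundary point the incoming velocity is mirrored in the tangent hyperplane; if it is
  tangent to the boundary, this leaves it unchanged.
\<close>

definition billiard_path :: "(real ^ 'm) set \<Rightarrow> real set \<Rightarrow> (real \<Rightarrow> real ^ 'm) \<Rightarrow> bool" where
  "billiard_path S I T \<longleftrightarrow>
     (\<forall>t\<in>I. \<forall>k. T t \<notin> interior (lifted_obstacle S k)) \<and>
     (\<forall>t\<in>I. (\<exists>t'\<in>I. t' < t) \<longrightarrow> (\<exists>v. norm v = 1 \<and> incoming_velocity T t v)) \<and>
     (\<forall>t\<in>I. (\<exists>t'\<in>I. t < t') \<longrightarrow> (\<exists>w. norm w = 1 \<and> outgoing_velocity T t w)) \<and>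
     (\<forall>t\<in>interior I. \<forall>v w. incoming_velocity T t v \<and> outgoing_velocity T t w \<longrightarrow>
        (\<forall>k \<nu>. outer_unit_normal (lifted_obstacle S k) (T t) \<nu> \<longrightarrow>
             w = v - (2 * (v \<bullet> \<nu>)) *\<^sub>R \<nu>) \<and>
        ((\<forall>k. T t \<notin> frontier (lifted_obstacle S k)) \<longrightarrow> w = v))"

text \<open>The condition \<open>v \<bullet> \<nu> \<noteq> 0\<close> excludes tangencies.\<close>

definition reflects_at ::
    "(real ^ 'm) set \<Rightarrow> (real \<Rightarrow> real ^ 'm) \<Rightarrow> real \<Rightarrow> int ^ 'm \<Rightarrow> bool" where
  "reflects_at S T t k \<longleftrightarrow>
     (\<exists>v \<nu>. incoming_velocity T t v \<and> outer_unit_normal (lifted_obstacle S k) (T t) \<nu> \<and>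
            v \<bullet> \<nu> \<noteq> 0)"

text \<open>
  In both definitions of type, \<open>\<tau>\<close> enumerates all reflection times in increasing order, so
  that there are no reflections other than the listed ones.
\<close>

definition trajectory_of_type ::
    "(real ^ 'm) set \<Rightarrow> (nat \<Rightarrow> int ^ 'm) \<Rightarrow> (real \<Rightarrow> real ^ 'm) \<Rightarrow> bool" where
  "trajectory_of_type S k T \<longleftrightarrow>
     billiard_path S {0..} T \<and> k 0 = 0 \<and> T 0 \<in> frontier (lifted_obstacle S (k 0)) \<and>
     (\<exists>\<tau> :: nat \<Rightarrow> real. strict_mono \<tau> \<and> \<tau> 0 = 0 \<and>
        {t. 0 < t \<and> (\<exists>j. reflects_at S T t j)} = \<tau> ` {1..} \<and>
        (\<forall>n\<ge>1. reflects_at S T (\<tau> n) (k n)))"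

text \<open>A piece of length \<open>L\<close> and type \<open>(k 0, \<dots>, k s)\<close>; the values \<open>k n\<close> for \<open>n > s\<close> are irrelevant.\<close>

definition piece_of_type ::
    "(real ^ 'm) set \<Rightarrow> nat \<Rightarrow> (nat \<Rightarrow> int ^ 'm) \<Rightarrow> real \<Rightarrow> (real \<Rightarrow> real ^ 'm) \<Rightarrow> bool" where
  "piece_of_type S s k L T \<longleftrightarrow>
     billiard_path S {0..L} T \<and> k 0 = 0 \<and>
     T 0 \<in> frontier (lifted_obstacle S (k 0)) \<and> T L \<in> frontier (lifted_obstacle S (k s)) \<and>
     (\<exists>\<tau> :: nat \<Rightarrow> real. strict_mono_on {0..s} \<tau> \<and> \<tau> 0 = 0 \<and> \<tau> s = L \<and>
        {t. 0 < t \<and> t < L \<and> (\<exists>j. reflects_at S T t j)} = \<tau> ` {1..<s} \<and>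
        (\<forall>n\<in>{1..<s}. reflects_at S T (\<tau> n) (k n)))"


section \<open>Admissibility and rotation vectors\<close>

definition between :: "(real ^ 'm) set \<Rightarrow> int ^ 'm \<Rightarrow> int ^ 'm \<Rightarrow> int ^ 'm \<Rightarrow> bool" where
  "between S i k j \<longleftrightarrow>
     k \<noteq> i \<and> k \<noteq> j \<and>
     lifted_obstacle S k \<inter> convex hull (lifted_obstacle S i \<union> lifted_obstacle S j) \<noteq> {}"

text \<open>The index set \<open>N\<close> is \<open>{..s}\<close> for finite and \<open>UNIV\<close> for infinite sequences.\<close>

definition admissible :: "(real ^ 'm) set \<Rightarrow> nat set \<Rightarrow> (nat \<Rightarrow> int ^ 'm) \<Rightarrow> bool" where
  "admissible S N k \<longleftrightarrow>
     k 0 = 0 \<and>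
     (\<forall>n. n + 1 \<in> N \<longrightarrow> k (n + 1) \<noteq> k n) \<and>
     (\<forall>n. n + 1 \<in> N \<longrightarrow> (\<forall>j. \<not> between S (k n) j (k (n + 1)))) \<and>
     (\<forall>n. n + 2 \<in> N \<longrightarrow> \<not> between S (k n) (k (n + 1)) (k (n + 2)))"

definition admissible_rotation_set :: "(real ^ 'm) set \<Rightarrow> (real ^ 'm) set" where
  "admissible_rotation_set S =
     {w. \<exists>(x :: nat \<Rightarrow> real ^ 'm) (y :: nat \<Rightarrow> real ^ 'm) (t :: nat \<Rightarrow> real).
           (\<forall>n. \<exists>s k T. admissible S {..s} k \<and> piece_of_type S s k (t n) T \<and>
                        T 0 = x n \<and> T (t n) = y n) \<and>
           filterlim t at_top sequentially \<and>
           (\<lambda>n. (y n - x n) /\<^sub>R t n) \<longlonglongrightarrow> w}"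

definition has_rotation_vector :: "(real \<Rightarrow> real ^ 'm) \<Rightarrow> real ^ 'm \<Rightarrow> bool" where
  "has_rotation_vector T u \<longleftrightarrow> ((\<lambda>t. (T t - T 0) /\<^sub>R t) \<longlongrightarrow> u) at_top"

end

theory Submission
  imports Defs
begin

text \<open>
  Trajectories of admissible type are obtained from shortest broken lines. Choose one vertex in each
  obstacle of an admissible sequence so that the length is minimal. At a minimum the change of the
  unit velocity at a vertex is normal to the convex obstacle (\<open>shortest_two_legs_normal\<close>), which is
  the law of reflection, and admissibility says that the line really turns at each vertex and meets
  no other obstacle. For infinite sequences a compactness argument (\<open>exists_prefix_minimal\<close>) gives
  a broken line all of whose initial parts are minimal, hence a trajectory (\<open>trajectory_T\<close>).
  Its travel time to the \<open>n\<close>-th vertex differs by at most \<open>1\<close> from the least length of a broken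
  line with the first \<open>n\<close> steps, a number that does not depend on later steps.

  So it remains to find an admissible sequence whose displacement stays within bounded distance of
  \<open>u\<close> times this least length. Admissible sequences are walks in a graph of steps, and for a small
  obstacle any two walks can be joined by at most one unit step (\<open>connect\<close>). Because \<open>u\<close> is an
  interior point, for each direction \<open>z\<close> there is a long walk whose deviation from \<open>u\<close> points
  strongly against \<open>z\<close> (\<open>walk_against_direction\<close>), and by compactness of the sphere finitely
  many walks serve all directions. Appending again and again a walk that points against the
  deviation accumulated so far keeps this deviation bounded (\<open>steered_walk\<close>). The resulting
  trajectory stays within bounded distance of the line \<open>T 0 + t u\<close>.
\<close>

section \<open>Lattice steps and lifted obstacles\<close>

lemma lattice_point_add: "lattice_point (a + b) = lattice_point a + lattice_point b"
  by (simp add: lattice_point_def vec_eq_iff)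

lemma lattice_point_0 [simp]: "lattice_point 0 = 0"
  by (simp add: lattice_point_def vec_eq_iff)

lemma lattice_point_diff: "lattice_point (a - b) = lattice_point a - lattice_point b"
  by (simp add: lattice_point_def vec_eq_iff)

lemma norm_lattice_point_ge_1:
  fixes d :: "int ^ 'm::finite"
  assumes "d \<noteq> 0"
  shows "1 \<le> norm (lattice_point d)"
proof -
  obtain i where i: "d $ i \<noteq> 0"
    using assms by (auto simp: vec_eq_iff)
  then have "1 \<le> \<bar>lattice_point d $ i\<bar>"
    by (simp add: lattice_point_def flip: of_int_abs)
  also have "\<dots> \<le> norm (lattice_point d)"
    by (rule component_le_norm_cart)
  finally show ?thesis .
qed

lemma mem_lifted_obstacle_iff: "z \<in> lifted_obstacle S k \<longleftrightarrow> z - lattice_point k \<in> S"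
  unfolding lifted_obstacle_def by (auto simp: image_iff algebra_simps intro: bexI[of _ "z - lattice_point k"])

lemma lifted_obstacle_eq_translation: "lifted_obstacle S k = (+) (lattice_point k) ` S"
  unfolding lifted_obstacle_def by (simp add: add.commute)

lemma frontier_lifted_obstacle_iff:
  "z \<in> frontier (lifted_obstacle S k) \<longleftrightarrow> z - lattice_point k \<in> frontier S"
proof -
  have "frontier (lifted_obstacle S k) = lifted_obstacle (frontier S) k"
    by (simp add: lifted_obstacle_eq_translation frontier_translation)
  then show ?thesis by (simp add: mem_lifted_obstacle_iff)
qed

lemma between_translate: "between S (i + t) (k + t) (j + t) \<longleftrightarrow> between S i k j"
proof -
  have tr: "lifted_obstacle S (a + t) = (+) (lattice_point t) ` lifted_obstacle S a" for a
    by (simp add: lifted_obstacle_eq_translation lattice_point_add image_image algebra_simps)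
  show ?thesis
    unfolding between_def tr image_Un[symmetric] convex_hull_translation
    by (auto simp flip: image_Int)
qed

lemma between_sub: "between S i k j \<longleftrightarrow> between S 0 (k - i) (j - i)"
  using between_translate[of S 0 i "k - i" "j - i"] by simp

locale small_billiard =
  fixes S :: "(real ^ 'm::finite) set"
  assumes obstacle: "obstacle S" and small: "small_obstacle S"
begin

lemma compact: "compact S" and closed: "closed S"
  and convex: "convex S" and smooth: "smooth_boundary S"
  using obstacle by (auto simp: obstacle_def strictly_convex_def compact_imp_closed)

lemma nonempty: "S \<noteq> {}"
  using obstacle interior_subset[of S] by (auto simp: obstacle_def)

lemma lifts_disjoint:
  assumes "z \<in> lifted_obstacle S j" "z \<in> lifted_obstacle S k"
  shows "j = k"
  using assms obstacle by (auto simp: obstacle_def)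

lemma norm_diff_less:
  assumes "p \<in> S" "q \<in> S"
  shows "norm (p - q) < sqrt 2 / 2"
proof -
  obtain c r where "r < sqrt 2 / 4" "S \<subseteq> cball c r"
    using small by (auto simp: small_obstacle_def)
  with assms have "dist c p \<le> r" "dist c q \<le> r" by auto
  then have "dist p q \<le> 2 * r"
    using dist_triangle3[of p q c] by simp
  with \<open>r < sqrt 2 / 4\<close> show ?thesis by (simp add: dist_norm)
qed

lemma norm_diff_less_1:
  assumes "p \<in> S" "q \<in> S"
  shows "norm (p - q) < 1"
proof -
  have "sqrt 2 / 2 < (1::real)" using real_sqrt_less_mono[of 2 4] by simp
  with norm_diff_less[OF assms] show ?thesis by simp
qed

lemma gap_pos: "0 < 1 - sqrt 2 / 2"
  using real_sqrt_less_mono[of 2 4] by simp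

lemma step_length_ge:
  assumes "d \<noteq> 0" "p \<in> S" "q \<in> S"
  shows "1 - sqrt 2 / 2 < norm (q - p + lattice_point d)"
  using norm_triangle_ineq2[of "lattice_point d" "p - q"] norm_lattice_point_ge_1[OF assms(1)]
    norm_diff_less[OF assms(2,3)] by (simp add: algebra_simps norm_minus_commute)

text \<open>
  Smallness enters the combinatorics through this consequence, which forgets the shape of the
  obstacle and keeps the diameter bound \<open>sqrt 2 / 2\<close>: a point of the convex hull is a point of a
  translate of \<open>S\<close> that slides along the segment joining the two lattice points.
\<close>

lemma between_imp_close:
  assumes "between S 0 k j"
  obtains t where "0 \<le> t" "t \<le> 1" "norm (lattice_point k - t *\<^sub>R lattice_point j) < sqrt 2 / 2"
proof -
  obtain z where zk: "z \<in> lifted_obstacle S k"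
    and zh: "z \<in> convex hull (lifted_obstacle S 0 \<union> lifted_obstacle S j)"
    using assms by (auto simp: between_def)
  have cvx: "convex (lifted_obstacle S i)" for i
    using convex by (simp add: lifted_obstacle_eq_translation convex_translation)
  have ne: "lifted_obstacle S i \<noteq> {}" for i
    using nonempty by (simp add: lifted_obstacle_def)
  obtain a b u v where ab: "a \<in> lifted_obstacle S 0" "b \<in> lifted_obstacle S j"
    and uv: "0 \<le> u" "0 \<le> v" "u + v = 1" and z: "z = u *\<^sub>R a + v *\<^sub>R b"
    using zh unfolding convex_hull_union_two[OF cvx ne cvx ne] by auto
  define q where "q = b - lattice_point j"
  have "a \<in> S" "q \<in> S" using ab by (auto simp: q_def mem_lifted_obstacle_iff)
  then have "u *\<^sub>R a + v *\<^sub>R q \<in> S"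
    using convex uv by (auto simp: convex_def)
  moreover have "z - lattice_point k \<in> S" using zk by (simp add: mem_lifted_obstacle_iff)
  ultimately have "norm ((u *\<^sub>R a + v *\<^sub>R q) - (z - lattice_point k)) < sqrt 2 / 2"
    by (rule norm_diff_less)
  also have "(u *\<^sub>R a + v *\<^sub>R q) - (z - lattice_point k) = lattice_point k - v *\<^sub>R lattice_point j"
    by (simp add: z q_def algebra_simps)
  finally show ?thesis using that uv by auto
qed

text \<open>
  Conditions on consecutive members of an admissible sequence are invariant under translation, so
  they are conditions on the steps: each step is free, and consecutive steps bend. An admissible
  sequence is the same thing as a walk in the graph whose vertices are the free steps and whose
  arrows are given by \<open>bends\<close>.
\<close>

definition free_step :: "int ^ 'm \<Rightarrow> bool" where
  "free_step d \<longleftrightarrow> d \<noteq> 0 \<and> (\<forall>j. \<not> between S 0 j d)"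

definition bends :: "int ^ 'm \<Rightarrow> int ^ 'm \<Rightarrow> bool" where
  "bends d e \<longleftrightarrow> \<not> between S 0 d (d + e)"

definition walk :: "(int ^ 'm) list \<Rightarrow> bool" where
  "walk ds \<longleftrightarrow> (\<forall>d\<in>set ds. free_step d) \<and> successively bends ds"

text \<open>
  The point of smallness. If the angle between the steps is at least a right angle, the triangle with
  vertices \<open>0\<close>, \<open>d\<close>, \<open>d + e\<close> has an angle of at most ninety degrees at \<open>d\<close> and two
  sides of length at least \<open>1\<close> meeting there. Hence \<open>d\<close> has distance at least \<open>sqrt 2 / 2\<close> from the
  opposite side.
\<close>

lemma bends_if_inner_nonpos:
  assumes "d \<noteq> 0" "e \<noteq> 0" and de: "lattice_point d \<bullet> lattice_point e \<le> 0"
  shows "bends d e"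
  unfolding bends_def
proof
  assume "between S 0 d (d + e)"
  then obtain t where t: "0 \<le> t" "t \<le> 1"
    and close: "norm (lattice_point d - t *\<^sub>R lattice_point (d + e)) < sqrt 2 / 2"
    by (rule between_imp_close)
  let ?d = "lattice_point d" and ?e = "lattice_point e"
  have "(norm (lattice_point d - t *\<^sub>R lattice_point (d + e)))\<^sup>2 < (sqrt 2 / 2)\<^sup>2"
    using close by (intro power_strict_mono) auto
  then have "(norm (lattice_point d - t *\<^sub>R lattice_point (d + e)))\<^sup>2 < 1 / 2"
    by (simp add: power_divide)
  moreover have "(norm (lattice_point d - t *\<^sub>R lattice_point (d + e)))\<^sup>2
      = (1 - t)\<^sup>2 * (norm ?d)\<^sup>2 + t\<^sup>2 * (norm ?e)\<^sup>2 - 2 * (t * (1 - t)) * (?d \<bullet> ?e)"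
    unfolding power2_norm_eq_inner
    by (simp add: lattice_point_add inner_diff inner_add algebra_simps inner_commute power2_eq_square)
  moreover have "(1 - t)\<^sup>2 * 1 \<le> (1 - t)\<^sup>2 * (norm ?d)\<^sup>2" "t\<^sup>2 * 1 \<le> t\<^sup>2 * (norm ?e)\<^sup>2"
    by (rule mult_left_mono[OF one_le_power[OF norm_lattice_point_ge_1[OF assms(1)]]], simp)
      (rule mult_left_mono[OF one_le_power[OF norm_lattice_point_ge_1[OF assms(2)]]], simp)
  moreover have "2 * (t * (1 - t)) * (?d \<bullet> ?e) \<le> 0"
    using t de by (intro mult_nonneg_nonpos) auto
  moreover have "1 / 2 \<le> (1 - t)\<^sup>2 + t\<^sup>2"
    using sum_squares_bound[of "1 - t" t] by (simp add: power2_eq_square algebra_simps)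
  ultimately show False by linarith
qed

lemma free_step_axis:
  fixes i :: 'm
  assumes "s = 1 \<or> s = -1"
  shows "free_step (axis i s)"
  unfolding free_step_def
proof (intro conjI allI notI)
  show False if "axis i s = 0" using that assms by (auto simp: axis_eq_0_iff)
next
  fix j assume b: "between S 0 j (axis i s)"
  then have ne: "j \<noteq> 0" "j \<noteq> axis i s" by (auto simp: between_def)
  obtain t where t: "0 \<le> t" "t \<le> 1"
    and close: "norm (lattice_point j - t *\<^sub>R lattice_point (axis i s)) < sqrt 2 / 2"
    using b by (rule between_imp_close)
  have small_comp: "\<bar>real_of_int (j $ l) - t * real_of_int (axis i s $ l)\<bar> < 1" for l
    using component_le_norm_cart[of "lattice_point j - t *\<^sub>R lattice_point (axis i s)" l] close gap_pos
    by (simp add: lattice_point_def)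
  have off: "j $ l = 0" if "l \<noteq> i" for l
    using small_comp[of l] that by (simp add: axis_def flip: of_int_abs)
  have "j $ i = 0 \<or> j $ i = s"
  proof -
    have "s = 1 \<Longrightarrow> \<bar>real_of_int (j $ i) - t\<bar> < 1" "s = -1 \<Longrightarrow> \<bar>real_of_int (j $ i) + t\<bar> < 1"
      using small_comp[of i] by (auto simp: axis_def)
    moreover have "j $ i \<le> -2 \<or> j $ i = -1 \<or> j $ i = 0 \<or> j $ i = 1 \<or> 2 \<le> j $ i" by linarith
    then have "real_of_int (j $ i) \<le> -2 \<or> j $ i = -1 \<or> j $ i = 0 \<or> j $ i = 1 \<or> 2 \<le> real_of_int (j $ i)"
      by linarith
    ultimately show ?thesis using assms t by (auto simp: abs_if split: if_splits)
  qed
  moreover have "j $ l = axis i (j $ i) $ l" for l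
    using off[of l] by (cases "l = i") (simp_all add: axis_def)
  then have "j = axis i (j $ i)" unfolding vec_eq_iff by blast
  ultimately show False using ne by (metis axis_eq_0_iff)
qed

lemma norm_lattice_point_axis: "norm (lattice_point (axis i s :: int ^ 'm)) = \<bar>of_int s\<bar>"
proof -
  have "lattice_point (axis i s :: int ^ 'm) = of_int s *\<^sub>R axis i 1"
    by (auto simp: lattice_point_def axis_def vec_eq_iff)
  then show ?thesis by simp
qed

lemma inner_lattice_point_axis:
  "lattice_point d \<bullet> lattice_point (axis i s :: int ^ 'm) = of_int (d $ i * s)"
proof -
  have "lattice_point (axis i s :: int ^ 'm) = axis i (of_int s)"
    by (auto simp: lattice_point_def axis_def vec_eq_iff)
  then show ?thesis by (simp add: inner_axis lattice_point_def)
qed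

text \<open>
  Any two free steps can be joined at bounded cost: either they already form an angle of at least
  ninety degrees, or some coordinate has the same sign in both, and the unit step against that
  coordinate may be inserted. The bound does not depend on the steps; this is what makes the cost
  of joining walks controllable.
\<close>

lemma connect:
  assumes "free_step d" "free_step e"
  obtains c where "length c \<le> 1" "\<And>a. a \<in> set c \<Longrightarrow> free_step a \<and> norm (lattice_point a) = 1"
    "successively bends (d # c @ [e])"
proof -
  have ne: "d \<noteq> 0" "e \<noteq> 0" using assms by (auto simp: free_step_def)
  show ?thesis
  proof (cases "lattice_point d \<bullet> lattice_point e \<le> 0")
    case True
    then show ?thesis using that[of "[]"] ne by (simp add: bends_if_inner_nonpos)
  next
    case False
    have "\<exists>i. d $ i * e $ i > 0"
    proof (rule ccontr)
      assume "\<not> ?thesis"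
      then have "(\<Sum>i\<in>UNIV. real_of_int (d $ i * e $ i)) \<le> 0"
        by (intro sum_nonpos) (auto simp: not_less simp del: of_int_mult)
      with False show False by (simp add: inner_vec_def lattice_point_def)
    qed
    then obtain i where i: "d $ i * e $ i > 0" by blast
    define s where "s = - sgn (d $ i)"
    have s: "s = 1 \<or> s = -1" using i by (auto simp: s_def sgn_if)
    let ?a = "axis i s :: int ^ 'm"
    have a: "free_step ?a" "norm (lattice_point ?a) = 1"
      using free_step_axis[OF s] s by (auto simp: norm_lattice_point_axis)
    have "d $ i * s \<le> 0" "e $ i * s \<le> 0"
      using i by (auto simp: s_def sgn_if zero_less_mult_iff)
    then have "bends d ?a" "bends ?a e"
      using a(1) ne by (auto intro!: bends_if_inner_nonpos simp: inner_lattice_point_axis 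
          inner_commute[of "lattice_point ?a"] free_step_def simp del: of_int_mult)
    then show ?thesis using that[of "[?a]"] a by simp
  qed
qed

end

section \<open>Normals and the law of reflection\<close>

lemma unit_vectors_inner_less_1:
  fixes v w :: "'a::real_inner"
  assumes "norm v = 1" "norm w = 1" "v \<noteq> w"
  shows "v \<bullet> w < 1"
proof -
  have "0 < (v - w) \<bullet> (v - w)" using assms by simp
  also have "\<dots> = 2 - 2 * (v \<bullet> w)"
    using assms by (simp add: inner_diff inner_commute norm_eq_1)
  finally show ?thesis by simp
qed

text \<open>
  At a boundary point with a \<open>C\<^sup>1\<close> defining function the normal cone lies in a single ray:
  every direction in which the defining function decreases points into the set, so a normal
  functional cannot be positive on the open half space of these directions.
\<close>

lemma outer_normal_unique:
  fixes A :: "'a::euclidean_space set"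
  assumes \<nu>: "outer_unit_normal A x \<nu>" and "closed A" and "c \<noteq> 0"
    and c: "\<And>y. y \<in> A \<Longrightarrow> c \<bullet> (y - x) \<le> 0"
  shows "\<nu> = c /\<^sub>R norm c"
proof -
  obtain U f g where U: "open U" "x \<in> U" and f: "(f has_derivative (\<lambda>h. g x \<bullet> h)) (at x)"
    and g0: "g x \<noteq> 0" and A: "A \<inter> U = {y \<in> U. f y \<le> 0}" and \<nu>_eq: "\<nu> = g x /\<^sub>R norm (g x)"
    and fr: "x \<in> frontier A"
    using \<nu> by (auto simp: outer_unit_normal_def local_defining_function_def)
  have "x \<in> A" using fr \<open>closed A\<close> frontier_subset_closed by blast
  then have fx: "f x \<le> 0" using A U by auto
  \<comment> \<open>A direction that decreases \<open>f\<close> to first order points into \<open>A\<close>.\<close>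
  have inward: "c \<bullet> h \<le> 0" if h: "g x \<bullet> h < 0" for h
  proof -
    have "((\<lambda>t. f (x + t *\<^sub>R h)) has_real_derivative g x \<bullet> h) (at 0)"
    proof -
      have "((\<lambda>t. f (x + t *\<^sub>R h)) has_derivative (\<lambda>t. g x \<bullet> (t *\<^sub>R h))) (at 0)"
        by (rule has_derivative_compose[where f = "\<lambda>t. x + t *\<^sub>R h" and g = f])
          (auto intro!: derivative_eq_intros f)
      then show ?thesis by (simp add: has_field_derivative_def mult_commute_abs)
    qed
    from DERIV_neg_dec_right[OF this h] obtain d where d: "d > 0"
      "\<And>t. 0 < t \<Longrightarrow> t < d \<Longrightarrow> f (x + t *\<^sub>R h) < f x" by auto
    have "((\<lambda>t. x + t *\<^sub>R h) \<longlongrightarrow> x + 0 *\<^sub>R h) (at_right 0)"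
      by (intro tendsto_intros)
    then have "\<forall>\<^sub>F t in at_right 0. x + t *\<^sub>R h \<in> U"
      using U by (auto dest: topological_tendstoD)
    moreover have "\<forall>\<^sub>F t in at_right 0. t \<in> {0<..<d}"
      using d(1) by (rule eventually_at_right_real)
    ultimately have "\<forall>\<^sub>F t in at_right 0. 0 < t \<and> t < d \<and> x + t *\<^sub>R h \<in> U"
      by eventually_elim auto
    from eventually_happens'[OF trivial_limit_at_right_real this]
    obtain t where t: "0 < t" "t < d" "x + t *\<^sub>R h \<in> U"
      by blast
    with d(2)[of t] fx have "x + t *\<^sub>R h \<in> {y \<in> U. f y \<le> 0}" by simp
    then have "x + t *\<^sub>R h \<in> A" unfolding A[symmetric] by blast
    from c[OF this] t show ?thesis by (simp add: mult_le_0_iff)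
  qed
  define e where "e = c /\<^sub>R norm c"
  have e: "norm e = 1" "norm \<nu> = 1"
    using g0 \<open>c \<noteq> 0\<close> by (simp_all add: e_def \<nu>_eq)
  obtain n1 where n1: "n1 > 0" "c = n1 *\<^sub>R e"
    using that[of "norm c"] \<open>c \<noteq> 0\<close> by (simp add: e_def)
  obtain n2 where n2: "n2 > 0" "g x = n2 *\<^sub>R \<nu>"
    using that[of "norm (g x)"] g0 by (simp add: \<nu>_eq)
  have "\<nu> = e"
  proof (rule ccontr)
    assume "\<nu> \<noteq> e"
    then have k: "\<nu> \<bullet> e < 1" using e by (intro unit_vectors_inner_less_1) auto
    have "\<nu> \<bullet> (e - \<nu>) < 0" "0 < e \<bullet> (e - \<nu>)"
      using e k by (simp_all add: inner_diff_right norm_eq_1 inner_commute)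
    then have "g x \<bullet> (e - \<nu>) < 0" "0 < c \<bullet> (e - \<nu>)"
      using n1(1) n2(1) unfolding n1(2) n2(2) by (simp_all add: mult_pos_neg)
    then show False using inward[of "e - \<nu>"] by simp
  qed
  then show ?thesis by (simp add: e_def)
qed

lemma not_interior_if_normal:
  fixes A :: "'a::euclidean_space set"
  assumes "c \<noteq> 0" and c: "\<And>y. y \<in> A \<Longrightarrow> c \<bullet> (y - x) \<le> 0"
  shows "x \<notin> interior A"
proof
  assume "x \<in> interior A"
  then obtain e where "e > 0" "ball x e \<subseteq> A" by (auto simp: mem_interior)
  have "x + (e / (2 * norm c)) *\<^sub>R c \<in> ball x e"
    using \<open>c \<noteq> 0\<close> \<open>e > 0\<close> by (simp add: dist_norm)
  with \<open>ball x e \<subseteq> A\<close> have "x + (e / (2 * norm c)) *\<^sub>R c \<in> A" by (rule subsetD)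
  from c[OF this] have "(e / (2 * norm c)) * (c \<bullet> c) \<le> 0" by simp
  moreover have "(e / (2 * norm c)) * (c \<bullet> c) > 0" using \<open>e > 0\<close> \<open>c \<noteq> 0\<close> by simp
  ultimately show False by simp
qed

text \<open>
  The law of reflection says that the change of velocity is normal to the boundary. Between two
  different unit velocities the length of this change is then forced, so nothing else has to be
  checked; the incidence is never tangential because the two velocities differ.
\<close>

lemma reflection_from_difference:
  fixes v w :: "'a::real_inner"
  assumes "norm v = 1" "norm w = 1" "v \<noteq> w" "\<nu> = (w - v) /\<^sub>R norm (w - v)"
  shows "w = v - (2 * (v \<bullet> \<nu>)) *\<^sub>R \<nu>" and "v \<bullet> \<nu> \<noteq> 0"
proof -
  define c where "c = w - v"
  define k where "k = 1 - v \<bullet> w"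
  have k: "k > 0" using unit_vectors_inner_less_1[OF assms(1-3)] by (simp add: k_def)
  have cc: "c \<bullet> c = 2 * k" and vc: "v \<bullet> c = - k"
    using assms(1,2) by (simp_all add: c_def k_def inner_diff inner_commute norm_eq_1)
  have n: "norm c * norm c = 2 * k" "norm c \<noteq> 0"
    using cc k by (auto simp: dot_square_norm power2_eq_square)
  have vn: "v \<bullet> \<nu> = - k / norm c"
    unfolding assms(4) c_def[symmetric] inner_scaleR_right vc by (simp add: divide_inverse)
  then show "v \<bullet> \<nu> \<noteq> 0" using k n by simp
  have "2 * (v \<bullet> \<nu>) * inverse (norm c) = - (2 * k) / (norm c * norm c)"
    unfolding vn by (simp add: divide_inverse)
  also have "\<dots> = - 1" unfolding n(1) using k by simp
  finally have 1: "2 * (v \<bullet> \<nu>) * inverse (norm c) = - 1" .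
  have "\<nu> = inverse (norm c) *\<^sub>R c" using assms(4) by (simp add: c_def)
  then have "(2 * (v \<bullet> \<nu>)) *\<^sub>R \<nu> = (2 * (v \<bullet> \<nu>) * inverse (norm c)) *\<^sub>R c"
    by (metis scaleR_scaleR)
  then have "(2 * (v \<bullet> \<nu>)) *\<^sub>R \<nu> = - c" unfolding 1 by simp
  then show "w = v - (2 * (v \<bullet> \<nu>)) *\<^sub>R \<nu>" by (simp add: c_def)
qed

lemma has_derivative_norm_line:
  fixes z h :: "'a::real_inner"
  assumes "z \<noteq> 0"
  shows "((\<lambda>t. norm (z + t *\<^sub>R h)) has_real_derivative sgn z \<bullet> h) (at 0)"
proof -
  have "((\<lambda>t. norm (z + t *\<^sub>R h)) has_derivative (\<lambda>t. (t *\<^sub>R h) \<bullet> sgn z)) (at 0)"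
    by (rule has_derivative_compose[where f = "\<lambda>t. z + t *\<^sub>R h" and g = norm])
      (use assms in \<open>auto intro!: derivative_eq_intros has_derivative_norm\<close>)
  then show ?thesis by (simp add: has_field_derivative_def mult_commute_abs inner_commute)
qed

lemma DERIV_nonneg_if_right_min:
  fixes f :: "real \<Rightarrow> real"
  assumes f: "(f has_real_derivative l) (at 0)" and min: "\<And>t. 0 < t \<Longrightarrow> t \<le> 1 \<Longrightarrow> f 0 \<le> f t"
  shows "0 \<le> l"
proof (rule ccontr)
  assume "\<not> 0 \<le> l"
  with DERIV_neg_dec_right[OF f] obtain d where d: "d > 0" "\<And>h. 0 < h \<Longrightarrow> h < d \<Longrightarrow> f h < f 0"
    by auto
  define t where "t = min 1 (d / 2)"
  have "0 < t" "t \<le> 1" "t < d" using d(1) by (auto simp: t_def)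
  with d(2)[of t] min[of t] show False by simp
qed

text \<open>
  The gradient of the length at the middle point of a two-leg path is the difference of the two unit
  velocities. Minimality over a convex set makes this difference a normal vector of the set: this is
  how reflections arise from shortest paths.
\<close>

lemma shortest_two_legs_normal:
  fixes A :: "'a::real_inner set"
  assumes "convex A" "x \<in> A" "x \<noteq> a" "x \<noteq> b"
    and min: "\<And>y. y \<in> A \<Longrightarrow> norm (x - a) + norm (b - x) \<le> norm (y - a) + norm (b - y)"
    and "y \<in> A"
  shows "(sgn (b - x) - sgn (x - a)) \<bullet> (y - x) \<le> 0"
proof -
  let ?f = "\<lambda>t. norm ((x - a) + t *\<^sub>R (y - x)) + norm ((b - x) + t *\<^sub>R (x - y))"
  have "(?f has_real_derivative sgn (x - a) \<bullet> (y - x) + sgn (b - x) \<bullet> (x - y)) (at 0)"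
    using assms(3,4) by (intro DERIV_add has_derivative_norm_line) auto
  then have "0 \<le> sgn (x - a) \<bullet> (y - x) + sgn (b - x) \<bullet> (x - y)"
  proof (rule DERIV_nonneg_if_right_min)
    fix t :: real assume t: "0 < t" "t \<le> 1"
    have "(1 - t) *\<^sub>R x + t *\<^sub>R y \<in> A"
      using \<open>convex A\<close> \<open>x \<in> A\<close> \<open>y \<in> A\<close> t by (auto intro: convexD)
    from min[OF this] show "?f 0 \<le> ?f t" by (simp add: algebra_simps)
  qed
  then show ?thesis by (simp add: inner_diff algebra_simps)
qed

lemma shortest_leg_normal:
  fixes A :: "'a::real_inner set"
  assumes "convex A" "x \<in> A" "x \<noteq> b"
    and min: "\<And>y. y \<in> A \<Longrightarrow> norm (b - x) \<le> norm (b - y)"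
    and "y \<in> A"
  shows "sgn (b - x) \<bullet> (y - x) \<le> 0"
proof -
  let ?f = "\<lambda>t. norm ((b - x) + t *\<^sub>R (x - y))"
  have "(?f has_real_derivative sgn (b - x) \<bullet> (x - y)) (at 0)"
    using assms(3) by (intro has_derivative_norm_line) auto
  then have "0 \<le> sgn (b - x) \<bullet> (x - y)"
  proof (rule DERIV_nonneg_if_right_min)
    fix t :: real assume t: "0 < t" "t \<le> 1"
    have "(1 - t) *\<^sub>R x + t *\<^sub>R y \<in> A"
      using \<open>convex A\<close> \<open>x \<in> A\<close> \<open>y \<in> A\<close> t by (auto intro: convexD)
    from min[OF this] show "?f 0 \<le> ?f t" by (simp add: algebra_simps)
  qed
  then show ?thesis by (simp add: inner_diff algebra_simps)
qed

section \<open>Shortest broken lines\<close>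

text \<open>
  A broken line with vertices in the obstacles \<open>O\<^bsub>k n\<^esub>\<close> is described by the steps
  \<open>d n = k (n + 1) - k n\<close> and by points \<open>p n\<close> of \<open>S\<close>, its vertices being \<open>p n + k n\<close>. In these
  coordinates the domain of the length functional is the fixed compact set of all sequences in
  \<open>S\<close>, and translation invariance is built in.
\<close>

definition path_length :: "(nat \<Rightarrow> int ^ 'm) \<Rightarrow> (nat \<Rightarrow> real ^ 'm) \<Rightarrow> nat \<Rightarrow> real" where
  "path_length d p n = (\<Sum>i<n. norm (p (Suc i) - p i + lattice_point (d i)))"

lemma path_length_cong:
  assumes "\<And>i. i < n \<Longrightarrow> d i = d' i" "\<And>i. i \<le> n \<Longrightarrow> p i = p' i"
  shows "path_length d p n = path_length d' p' n"
  unfolding path_length_def using assms by (intro sum.cong) auto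

lemma path_length_nonneg: "0 \<le> path_length d p n"
  unfolding path_length_def by (intro sum_nonneg) auto

lemma path_length_Suc:
  "path_length d p (Suc n) = path_length d p n + norm (p (Suc n) - p n + lattice_point (d n))"
  by (simp add: path_length_def)

lemma path_length_add:
  "path_length d p (m + n) = path_length d p m + path_length (\<lambda>i. d (m + i)) (\<lambda>i. p (m + i)) n"
  by (induction n) (simp_all add: path_length_Suc, simp add: path_length_def)

lemma path_length_append:
  "path_length ((!) (A @ B)) p (length (A @ B))
    = path_length ((!) A) p (length A) + path_length ((!) B) (\<lambda>i. p (length A + i)) (length B)"
proof -
  have "path_length ((!) (A @ B)) p (length A) = path_length ((!) A) p (length A)"
    by (rule path_length_cong) (simp_all add: nth_append)
  then show ?thesis by (simp add: path_length_add)
qed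

lemma path_length_move_end:
  "path_length d (q(b := x)) b \<le> path_length d q b + norm (x - q b)"
proof (cases b)
  case 0
  then show ?thesis by (simp add: path_length_def)
next
  case (Suc n)
  have "path_length d (q(b := x)) n = path_length d q n"
    by (rule path_length_cong) (simp_all add: Suc)
  moreover have "norm (x - q n + lattice_point (d n))
      \<le> norm (q b - q n + lattice_point (d n)) + norm (x - q b)"
    using norm_triangle_ineq[of "q b - q n + lattice_point (d n)" "x - q b"] by (simp add: algebra_simps)
  ultimately show ?thesis by (simp add: Suc path_length_Suc)
qed

lemma path_length_move_start:
  "path_length d (q(0 := x)) n \<le> path_length d q n + norm (x - q 0)"
proof (cases n)
  case 0
  then show ?thesis by (simp add: path_length_def)
next
  case (Suc m)
  have "norm (q 1 - x + lattice_point (d 0)) \<le> norm (q 1 - q 0 + lattice_point (d 0)) + norm (x - q 0)"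
    using norm_triangle_ineq[of "q 1 - q 0 + lattice_point (d 0)" "q 0 - x"]
    by (simp add: algebra_simps norm_minus_commute)
  then show ?thesis
    unfolding path_length_def Suc by (subst (1 2) sum.lessThan_Suc_shift) simp
qed

lemma continuous_on_path_length: "continuous_on UNIV (\<lambda>p. path_length d p n)"
  unfolding path_length_def by (intro continuous_intros continuous_on_product_coordinates)

lemma continuous_on_path_length_fixed_end:
  "continuous_on UNIV (\<lambda>p. path_length d (q(b := p b)) n)"
proof -
  have "continuous_on UNIV (\<lambda>p. (q(b := p b)) i)" for i
    by (cases "i = b") simp_all
  then have "continuous_on UNIV (\<lambda>p. q(b := p b))"
    by (rule continuous_on_coordinatewise_then_product)
  from continuous_on_compose2[OF continuous_on_path_length this] show ?thesis by simp
qed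

context small_billiard
begin

text \<open>
  Every initial part is a shortest broken line among those with the same final vertex; the initial
  vertex is free. For infinite sequences this replaces minimality of the infinite total length. The
  condition for a single \<open>b\<close> is closed in the product topology and implies the one-vertex minimality
  that gives the law of reflection.
\<close>

definition prefix_minimal :: "(nat \<Rightarrow> int ^ 'm) \<Rightarrow> (nat \<Rightarrow> real ^ 'm) \<Rightarrow> bool" where
  "prefix_minimal d p \<longleftrightarrow> p \<in> UNIV \<rightarrow> S \<and>
     (\<forall>b. \<forall>q\<in>UNIV \<rightarrow> S. path_length d p b \<le> path_length d (q(b := p b)) b)"

lemma compact_point_sequences: "compact ((UNIV :: nat set) \<rightarrow> S)"
proof -
  have "compactin (product_topology (\<lambda>_::nat. euclidean) UNIV) (PiE UNIV (\<lambda>_. S))"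
    using compact by (subst compactin_PiE) simp
  then show ?thesis by (simp add: euclidean_product_topology PiE_UNIV_domain Pi_def)
qed

lemma point_sequences_nonempty: "(UNIV :: nat set) \<rightarrow> S \<noteq> {}"
  using nonempty by (auto simp: Pi_eq_empty)

text \<open>
  A minimiser of the length of the first \<open>N\<close> legs satisfies the conditions for all \<open>b \<le> N\<close>, and
  by compactness of the product space the conditions for all \<open>b\<close> can be met together.
\<close>

lemma exists_prefix_minimal: "\<exists>p. prefix_minimal d p"
proof -
  let ?P = "(UNIV :: nat set) \<rightarrow> S"
  define C where "C b = {p. \<forall>q\<in>?P. path_length d p b \<le> path_length d (q(b := p b)) b}" for b
  have "closed {p. path_length d p b \<le> path_length d (q(b := p b)) b}" for q b
    by (rule closed_Collect_le[OF continuous_on_path_length continuous_on_path_length_fixed_end])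
  then have "closed (\<Inter>q\<in>?P. {p. path_length d p b \<le> path_length d (q(b := p b)) b})" for b
    by (intro closed_INT) blast
  moreover have "C b = (\<Inter>q\<in>?P. {p. path_length d p b \<le> path_length d (q(b := p b)) b})" for b
    unfolding C_def by blast
  ultimately have closed: "closed (C b)" for b by simp
  have "?P \<inter> \<Inter> (C ` UNIV) \<noteq> {}"
  proof (rule compact_imp_fip_image[OF compact_point_sequences closed])
    fix I :: "nat set" assume "finite I"
    then obtain N where N: "\<And>b. b \<in> I \<Longrightarrow> b \<le> N" using finite_nat_set_iff_bounded_le by auto
    obtain p where p: "p \<in> ?P" and min: "\<And>q. q \<in> ?P \<Longrightarrow> path_length d p N \<le> path_length d q N"
      using continuous_attains_inf[OF compact_point_sequences point_sequences_nonempty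
          continuous_on_subset[OF continuous_on_path_length subset_UNIV]] by blast
    have "p \<in> C b" if "b \<in> I" for b
      unfolding C_def
    proof (intro CollectI ballI)
      fix q assume q: "q \<in> ?P"
      \<comment> \<open>Replacing only the first \<open>b\<close> points does not change the rest of the broken line.\<close>
      let ?r = "\<lambda>i. if i < b then q i else p i"
      obtain k where k: "N = b + k" using N[OF \<open>b \<in> I\<close>] le_Suc_ex by blast
      have "?r \<in> ?P" using p q by (auto simp: Pi_def)
      from min[OF this] have "path_length d p b \<le> path_length d ?r b"
        unfolding k path_length_add by simp
      also have "path_length d ?r b = path_length d (q(b := p b)) b"
        by (rule path_length_cong) auto
      finally show "path_length d p b \<le> path_length d (q(b := p b)) b" .
    qed
    with p show "?P \<inter> \<Inter> (C ` I) \<noteq> {}" by blast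
  qed
  then show ?thesis unfolding prefix_minimal_def C_def by blast
qed

definition min_length :: "(int ^ 'm) list \<Rightarrow> real" where
  "min_length ds = (INF p \<in> UNIV \<rightarrow> S. path_length ((!) ds) p (length ds))"

lemma min_length_le:
  assumes "p \<in> UNIV \<rightarrow> S"
  shows "min_length ds \<le> path_length ((!) ds) p (length ds)"
  unfolding min_length_def
  by (rule cINF_lower[OF bdd_belowI2[where m = 0] assms]) (rule path_length_nonneg)

lemma min_length_greatest:
  assumes "\<And>p. p \<in> UNIV \<rightarrow> S \<Longrightarrow> l \<le> path_length ((!) ds) p (length ds)"
  shows "l \<le> min_length ds"
  unfolding min_length_def using assms point_sequences_nonempty by (intro cINF_greatest) auto

lemma min_length_append_ge: "min_length A + min_length B \<le> min_length (A @ B)"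
proof (rule min_length_greatest)
  fix p assume p: "p \<in> (UNIV::nat set) \<rightarrow> S"
  then have "(\<lambda>i. p (length A + i)) \<in> UNIV \<rightarrow> S" by auto
  from min_length_le[OF p] min_length_le[OF this]
  show "min_length A + min_length B \<le> path_length ((!) (A @ B)) p (length (A @ B))"
    unfolding path_length_append by (rule add_mono)
qed

text \<open>
  Two broken lines are concatenated by moving the initial vertex of the second one to the final vertex
  of the first one, within the same copy of \<open>S\<close>, whose diameter is less than \<open>1\<close>.
\<close>

lemma min_length_append_le: "min_length (A @ B) \<le> min_length A + min_length B + 1"
proof -
  have "min_length (A @ B) - 1 - path_length ((!) A) p (length A) \<le> path_length ((!) B) q (length B)"
    if p: "p \<in> UNIV \<rightarrow> S" and q: "q \<in> UNIV \<rightarrow> S" for p q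
  proof -
    define r where "r i = (if i \<le> length A then p i else q (i - length A))" for i
    have "r \<in> UNIV \<rightarrow> S" using p q by (auto simp: r_def Pi_def)
    from min_length_le[OF this, of "A @ B"] have "min_length (A @ B) \<le>
        path_length ((!) A) r (length A) + path_length ((!) B) (\<lambda>i. r (length A + i)) (length B)"
      by (simp only: path_length_append)
    also have "path_length ((!) A) r (length A) = path_length ((!) A) p (length A)"
      by (rule path_length_cong) (auto simp: r_def)
    also have "(\<lambda>i. r (length A + i)) = q(0 := p (length A))" by (auto simp: r_def)
    also note path_length_move_start
    also have "norm (p (length A) - q 0) \<le> 1"
      using norm_diff_less_1[of "p (length A)" "q 0"] p q by (auto simp: Pi_def less_imp_le)
    finally show ?thesis by simp
  qed
  then have "min_length (A @ B) - 1 - path_length ((!) A) p (length A) \<le> min_length B"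
    if "p \<in> UNIV \<rightarrow> S" for p
    using that by (intro min_length_greatest) blast
  then have "min_length (A @ B) - 1 - min_length B \<le> path_length ((!) A) p (length A)"
    if "p \<in> UNIV \<rightarrow> S" for p
    using that by fastforce
  then have "min_length (A @ B) - 1 - min_length B \<le> min_length A"
    by (rule min_length_greatest)
  then show ?thesis by simp
qed

lemma min_length_nonneg: "0 \<le> min_length ds"
  by (rule min_length_greatest) (rule path_length_nonneg)

lemma min_length_le_norms: "min_length ds \<le> (\<Sum>d\<leftarrow>ds. norm (lattice_point d))"
proof -
  obtain z where "z \<in> S" using nonempty by auto
  then have "min_length ds \<le> path_length ((!) ds) (\<lambda>_. z) (length ds)" by (intro min_length_le) auto
  also have "\<dots> = (\<Sum>d\<leftarrow>ds. norm (lattice_point d))"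
    by (simp add: path_length_def sum_list_sum_nth atLeast0LessThan)
  finally show ?thesis .
qed

lemma min_length_ge_steps:
  assumes "0 \<notin> set ds"
  shows "real (length ds) * (1 - sqrt 2 / 2) \<le> min_length ds"
proof (rule min_length_greatest)
  fix p assume p: "p \<in> (UNIV::nat set) \<rightarrow> S"
  have "real (card {..<length ds}) * (1 - sqrt 2 / 2) \<le> path_length ((!) ds) p (length ds)"
    unfolding path_length_def
  proof (rule sum_bounded_below)
    fix i assume "i \<in> {..<length ds}"
    then have "ds ! i \<noteq> 0" using assms nth_mem by fastforce
    then show "1 - sqrt 2 / 2 \<le> norm (p (Suc i) - p i + lattice_point (ds ! i))"
      using step_length_ge[of "ds ! i" "p i" "p (Suc i)"] p by (auto simp: less_imp_le Pi_def)
  qed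
  then show "real (length ds) * (1 - sqrt 2 / 2) \<le> path_length ((!) ds) p (length ds)" by simp
qed

text \<open>
  This links the travel time of the infinite trajectory, which depends on the whole sequence of
  steps, to a quantity that depends only on the steps made so far.
\<close>

lemma prefix_minimal_length:
  assumes "prefix_minimal d p"
  shows "\<bar>path_length d p b - min_length (map d [0..<b])\<bar> \<le> 1"
proof -
  have eq: "path_length ((!) (map d [0..<b])) q (length (map d [0..<b])) = path_length d q b" for q
    by (simp, rule path_length_cong) auto
  have p: "p \<in> UNIV \<rightarrow> S" using assms by (simp add: prefix_minimal_def)
  have "path_length d p b - 1 \<le> path_length d q b" if q: "q \<in> UNIV \<rightarrow> S" for q
  proof -
    have "path_length d p b \<le> path_length d (q(b := p b)) b"
      using assms q by (simp add: prefix_minimal_def)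
    also note path_length_move_end
    also have "norm (p b - q b) \<le> 1"
      using norm_diff_less_1[of "p b" "q b"] p q by (auto simp: Pi_def less_imp_le)
    finally show ?thesis by simp
  qed
  then have "path_length d p b - 1 \<le> min_length (map d [0..<b])"
    by (intro min_length_greatest) (simp only: eq)
  moreover have "min_length (map d [0..<b]) \<le> path_length d p b"
    using min_length_le[OF p, of "map d [0..<b]"] by (simp only: eq)
  ultimately show ?thesis by linarith
qed

end

section \<open>From a minimal broken line to a billiard trajectory\<close>

lemma outer_unit_normal_exists:
  assumes "smooth_boundary S" and z: "z \<in> frontier (lifted_obstacle S k)"
  shows "\<exists>\<nu>. outer_unit_normal (lifted_obstacle S k) z \<nu>"
proof -
  let ?l = "lattice_point k"
  have "z - ?l \<in> frontier S" using z by (simp add: frontier_lifted_obstacle_iff)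
  then obtain U f g where l: "local_defining_function S (z - ?l) U f g"
    using assms(1) by (auto simp: smooth_boundary_def)
  have "local_defining_function (lifted_obstacle S k) z ((\<lambda>y. y - ?l) -` U)
      (\<lambda>y. f (y - ?l)) (\<lambda>y. g (y - ?l))"
    unfolding local_defining_function_def
  proof (intro conjI ballI)
    have U: "open U" using l by (simp add: local_defining_function_def)
    then show "open ((\<lambda>y. y - ?l) -` U)"
      by (intro open_vimage) (auto intro!: continuous_intros)
    show "z \<in> (\<lambda>y. y - ?l) -` U" using l by (simp add: local_defining_function_def)
    fix y assume y: "y \<in> (\<lambda>y. y - ?l) -` U"
    then show "g (y - ?l) \<noteq> 0" using l by (simp add: local_defining_function_def)
    have f: "(f has_derivative (\<lambda>h. g (y - ?l) \<bullet> h)) (at (y - ?l))"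
      using l y by (simp add: local_defining_function_def)
    have "((\<lambda>y. y - ?l) has_derivative (\<lambda>h. h)) (at y)"
      by (auto intro!: derivative_eq_intros)
    from has_derivative_compose[OF this f]
    show "((\<lambda>y. f (y - ?l)) has_derivative (\<lambda>h. g (y - ?l) \<bullet> h)) (at y)" .
  next
    have "continuous_on U g" using l by (simp add: local_defining_function_def)
    then show "continuous_on ((\<lambda>y. y - ?l) -` U) (\<lambda>y. g (y - ?l))"
      by (rule continuous_on_compose2) (auto intro!: continuous_intros)
    have "S \<inter> U = {y \<in> U. f y \<le> 0}" using l by (simp add: local_defining_function_def)
    then have eq: "y \<in> S \<and> y \<in> U \<longleftrightarrow> y \<in> U \<and> f y \<le> 0" for y by blast
    show "lifted_obstacle S k \<inter> (\<lambda>y. y - ?l) -` U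
        = {y \<in> (\<lambda>y. y - ?l) -` U. f (y - ?l) \<le> 0}"
      by (rule set_eqI, unfold mem_lifted_obstacle_iff Int_iff vimage_eq mem_Collect_eq) (rule eq)
  qed
  then show ?thesis using z unfolding outer_unit_normal_def by blast
qed

lemma incoming_velocity_unique:
  assumes "incoming_velocity T t v" "incoming_velocity T t w"
  shows "v = w"
proof -
  obtain a b where ab: "a > 0" "\<And>s. s \<in> {0..a} \<Longrightarrow> T (t - s) = T t - s *\<^sub>R v"
    "b > 0" "\<And>s. s \<in> {0..b} \<Longrightarrow> T (t - s) = T t - s *\<^sub>R w"
    using assms by (auto simp: incoming_velocity_def)
  have "T (t - min a b) = T t - min a b *\<^sub>R v" "T (t - min a b) = T t - min a b *\<^sub>R w"
    using ab(1,3) by (intro ab(2,4); simp)+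
  then have "min a b *\<^sub>R v = min a b *\<^sub>R w" by auto
  moreover have "min a b \<noteq> 0" using ab(1,3) by (simp add: min_def)
  ultimately show ?thesis by simp
qed

lemma outgoing_velocity_unique:
  assumes "outgoing_velocity T t v" "outgoing_velocity T t w"
  shows "v = w"
proof -
  obtain a b where ab: "a > 0" "\<And>s. s \<in> {0..a} \<Longrightarrow> T (t + s) = T t + s *\<^sub>R v"
    "b > 0" "\<And>s. s \<in> {0..b} \<Longrightarrow> T (t + s) = T t + s *\<^sub>R w"
    using assms by (auto simp: outgoing_velocity_def)
  have "T (t + min a b) = T t + min a b *\<^sub>R v" "T (t + min a b) = T t + min a b *\<^sub>R w"
    using ab(1,3) by (intro ab(2,4); simp)+
  then have "min a b *\<^sub>R v = min a b *\<^sub>R w" by auto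
  moreover have "min a b \<noteq> 0" using ab(1,3) by (simp add: min_def)
  ultimately show ?thesis by simp
qed

locale minimal_broken_line = small_billiard S
  for S :: "(real ^ 'm::finite) set" +
  fixes d :: "nat \<Rightarrow> int ^ 'm" and p :: "nat \<Rightarrow> real ^ 'm"
  assumes free: "\<And>n. free_step (d n)" and bend: "\<And>n. bends (d n) (d (Suc n))"
    and minimal: "prefix_minimal d p"
begin

definition k :: "nat \<Rightarrow> int ^ 'm" where "k n = (\<Sum>i<n. d i)"
definition x :: "nat \<Rightarrow> real ^ 'm" where "x n = p n + lattice_point (k n)"
definition w :: "nat \<Rightarrow> real ^ 'm" where "w n = sgn (x (Suc n) - x n)"
definition \<tau> :: "nat \<Rightarrow> real" where "\<tau> n = path_length d p n"

text \<open>An outer normal at the vertex \<open>x n\<close>: the change of velocity, or the direction of departure.\<close>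

definition c :: "nat \<Rightarrow> real ^ 'm" where "c n = (if n = 0 then w 0 else w n - w (n - 1))"

abbreviation Ob :: "nat \<Rightarrow> (real ^ 'm) set" where "Ob n \<equiv> lifted_obstacle S (k n)"

lemma k_Suc: "k (Suc n) = k n + d n"
  by (simp add: k_def)

lemma p_in: "p n \<in> S"
  using minimal by (auto simp: prefix_minimal_def)

lemma x_in: "x n \<in> Ob n"
  by (simp add: mem_lifted_obstacle_iff x_def p_in)

lemma step_nonzero: "d n \<noteq> 0"
  using free by (simp add: free_step_def)

lemma leg_eq: "x (Suc n) - x n = p (Suc n) - p n + lattice_point (d n)"
  by (simp add: x_def k_Suc lattice_point_add)

lemma \<tau>_Suc: "\<tau> (Suc n) = \<tau> n + norm (x (Suc n) - x n)"
  by (simp add: \<tau>_def path_length_Suc leg_eq)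

lemma \<tau>_0: "\<tau> 0 = 0"
  by (simp add: \<tau>_def path_length_def)

lemma leg_ge: "1 - sqrt 2 / 2 < norm (x (Suc n) - x n)"
  unfolding leg_eq by (rule step_length_ge[OF step_nonzero p_in p_in])

lemma leg_pos: "0 < norm (x (Suc n) - x n)"
  using leg_ge gap_pos by (rule order.strict_trans[rotated])

lemma norm_w: "norm (w n) = 1"
  using leg_pos by (simp add: w_def norm_sgn)

lemma x_Suc: "x (Suc n) = x n + norm (x (Suc n) - x n) *\<^sub>R w n"
  using leg_pos[of n] by (simp add: w_def sgn_div_norm)

lemma x_Suc_minimal:
  assumes "y \<in> Ob (Suc m)"
  shows "norm (x (Suc m) - x m) + norm (x (Suc (Suc m)) - x (Suc m))
    \<le> norm (y - x m) + norm (x (Suc (Suc m)) - y)"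
proof -
  let ?q = "p(Suc m := y - lattice_point (k (Suc m)))"
  have "?q \<in> UNIV \<rightarrow> S" using assms p_in by (simp add: mem_lifted_obstacle_iff)
  then have "path_length d p (Suc (Suc m)) \<le> path_length d (?q(Suc (Suc m) := p (Suc (Suc m)))) (Suc (Suc m))"
    using minimal unfolding prefix_minimal_def by blast
  also have "?q(Suc (Suc m) := p (Suc (Suc m))) = ?q" by auto
  finally have "path_length d p (Suc (Suc m)) \<le> path_length d ?q (Suc (Suc m))" .
  moreover have "path_length d ?q m = path_length d p m"
    by (rule path_length_cong) auto
  ultimately show ?thesis
    by (simp add: path_length_Suc leg_eq) (simp add: x_def k_Suc lattice_point_add algebra_simps)
qed

lemma x_0_minimal:
  assumes "y \<in> Ob 0"
  shows "norm (x 1 - x 0) \<le> norm (x 1 - y)"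
proof -
  let ?q = "p(0 := y - lattice_point (k 0))"
  have "?q \<in> UNIV \<rightarrow> S" using assms p_in by (simp add: mem_lifted_obstacle_iff)
  then have "path_length d p 1 \<le> path_length d (?q(1 := p 1)) 1"
    using minimal unfolding prefix_minimal_def by blast
  then show ?thesis
    by (simp add: path_length_def x_def k_def lattice_point_add algebra_simps)
qed

lemma segment_in_hull:
  assumes "a \<in> lifted_obstacle S i" "b \<in> lifted_obstacle S j" "0 \<le> t" "t \<le> 1"
  shows "(1 - t) *\<^sub>R a + t *\<^sub>R b \<in> convex hull (lifted_obstacle S i \<union> lifted_obstacle S j)"
  using assms by (intro convexD[OF convex_convex_hull] hull_inc) auto

text \<open>
  Going straight through \<open>x (Suc m)\<close> would place its obstacle between its two neighbours. This is
  where the last condition of admissibility is used, and it rules out that a vertex of the shortest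
  broken line is not a reflection.
\<close>

lemma w_turns: "w m \<noteq> w (Suc m)"
proof
  assume eq: "w m = w (Suc m)"
  define a b where "a = norm (x (Suc m) - x m)" and "b = norm (x (Suc (Suc m)) - x (Suc m))"
  have ab: "a > 0" "b > 0" using leg_pos by (simp_all add: a_def b_def)
  have x1: "x (Suc m) = x m + a *\<^sub>R w m" using x_Suc[of m] by (simp add: a_def)
  have "x (Suc (Suc m)) = x (Suc m) + b *\<^sub>R w m"
    using x_Suc[of "Suc m"] unfolding b_def eq .
  then have x2: "x (Suc (Suc m)) = x m + (a + b) *\<^sub>R w m"
    using x1 by (simp add: scaleR_add_left)
  define t where "t = a / (a + b)"
  have t: "0 \<le> t" "t \<le> 1" "t * (a + b) = a" using ab by (simp_all add: t_def)
  have "(1 - t) *\<^sub>R x m + t *\<^sub>R x (Suc (Suc m)) = x m + (t * (a + b)) *\<^sub>R w m"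
    unfolding x2 by (simp add: algebra_simps)
  then have "x (Suc m) \<in> convex hull (Ob m \<union> Ob (Suc (Suc m)))"
    using segment_in_hull[OF x_in x_in t(1,2), of m "Suc (Suc m)"] t(3) x1 by simp
  then have "between S (k m) (k (Suc m)) (k (Suc (Suc m)))"
    using x_in[of "Suc m"] step_nonzero[of m] step_nonzero[of "Suc m"]
    by (auto simp: between_def k_Suc)
  then have "between S 0 (d m) (d m + d (Suc m))"
    by (subst (asm) between_sub) (simp add: k_Suc add.assoc)
  then show False using bend by (simp add: bends_def)
qed

lemma convex_Ob: "convex (Ob n)"
  using convex by (simp add: lifted_obstacle_eq_translation convex_translation)

lemma closed_lifted: "closed (lifted_obstacle S j)"
  using closed by (simp add: lifted_obstacle_eq_translation closed_translation)

lemma c_normal: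
  assumes "y \<in> Ob n"
  shows "c n \<bullet> (y - x n) \<le> 0"
proof (cases n)
  case 0
  show ?thesis
    using shortest_leg_normal[OF convex_Ob x_in[of 0] _ x_0_minimal, of y] assms leg_pos[of 0]
    by (auto simp: c_def 0 w_def)
next
  case (Suc m)
  have "x (Suc m) \<noteq> x m" "x (Suc m) \<noteq> x (Suc (Suc m))" using leg_pos[of m] leg_pos[of "Suc m"] by auto
  from shortest_two_legs_normal[OF convex_Ob x_in this x_Suc_minimal] assms
  show ?thesis by (auto simp: c_def Suc w_def)
qed

lemma c_outgoing: "0 < c n \<bullet> w n"
proof (cases n)
  case 0
  then show ?thesis using norm_w[of 0] by (simp add: c_def norm_eq_1)
next
  case (Suc m)
  then show ?thesis using unit_vectors_inner_less_1[OF norm_w norm_w w_turns[of m]] norm_w[of n]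
    by (simp add: c_def norm_eq_1 inner_diff)
qed

lemma c_incoming: "c (Suc m) \<bullet> w m < 0"
  using unit_vectors_inner_less_1[OF norm_w norm_w w_turns[of m]] norm_w[of m]
  by (simp add: c_def norm_eq_1 inner_diff inner_commute)

lemma c_nonzero: "c n \<noteq> 0"
  using c_outgoing[of n] by auto

lemma x_not_interior: "x n \<notin> interior (Ob n)"
  by (rule not_interior_if_normal[OF c_nonzero c_normal])

lemma x_frontier: "x n \<in> frontier (Ob n)"
  using x_in x_not_interior closed_lifted by (simp add: frontier_def closure_closed)

text \<open>
  The two obstacles at the ends of a leg lie on the far sides of supporting hyperplanes, and all
  others are excluded because the step is free.
\<close>

lemma leg_avoids:
  assumes "0 < s" "s < norm (x (Suc n) - x n)"
  shows "x n + s *\<^sub>R w n \<notin> lifted_obstacle S j"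
proof
  assume z: "x n + s *\<^sub>R w n \<in> lifted_obstacle S j"
  define e where "e = norm (x (Suc n) - x n)"
  have e: "e > 0" "x (Suc n) = x n + e *\<^sub>R w n" "s < e"
    using leg_pos x_Suc assms by (simp_all add: e_def)
  have "j \<noteq> k n"
    using c_normal[of "x n + s *\<^sub>R w n" n] z assms(1) c_outgoing[of n] by (auto simp: mult_le_0_iff)
  moreover have "j \<noteq> k (Suc n)"
  proof
    assume "j = k (Suc n)"
    then have "c (Suc n) \<bullet> ((s - e) *\<^sub>R w n) \<le> 0"
      using c_normal[of "x n + s *\<^sub>R w n" "Suc n"] z by (simp add: e(2) algebra_simps)
    then show False using c_incoming[of n] e(3) by (simp add: mult_le_0_iff)
  qed
  moreover have "x n + s *\<^sub>R w n \<in> convex hull (Ob n \<union> Ob (Suc n))"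
  proof -
    have "(1 - s / e) *\<^sub>R x n + (s / e) *\<^sub>R x (Suc n) \<in> convex hull (Ob n \<union> Ob (Suc n))"
      using assms(1) e by (intro segment_in_hull x_in) auto
    also have "(1 - s / e) *\<^sub>R x n + (s / e) *\<^sub>R x (Suc n) = x n + s *\<^sub>R w n"
      using e(1) by (simp add: e(2) algebra_simps)
    finally show ?thesis .
  qed
  ultimately have "between S (k n) j (k (Suc n))" using z by (auto simp: between_def)
  then have "between S 0 (j - k n) (d n)"
    by (subst (asm) between_sub) (simp add: k_Suc)
  then show False using free by (simp add: free_step_def)
qed

lemma admissible_k: "admissible S UNIV k"
proof -
  have "\<not> between S (k n) j (k (Suc n))" for n j
    using free[of n] between_sub[of S "k n" j "k (Suc n)"] by (simp add: k_Suc free_step_def)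
  moreover have "\<not> between S (k n) (k (Suc n)) (k (Suc (Suc n)))" for n
    using bend[of n] between_sub[of S "k n" "k (Suc n)" "k (Suc (Suc n))"]
    by (simp add: k_Suc bends_def add.assoc)
  ultimately show ?thesis
    using step_nonzero by (simp add: admissible_def k_Suc[symmetric]) (simp add: k_def)
qed

lemma \<tau>_strict_mono: "strict_mono \<tau>"
  unfolding strict_mono_Suc_iff using leg_pos by (simp add: \<tau>_Suc)

lemma \<tau>_ge: "real n * (1 - sqrt 2 / 2) \<le> \<tau> n"
proof (induction n)
  case (Suc n)
  then show ?case
    using leg_ge[of n] unfolding \<tau>_Suc of_nat_Suc distrib_right mult_1_left by linarith
qed (simp add: \<tau>_0)

lemma leg_exists:
  assumes "0 \<le> t"
  obtains n where "\<tau> n \<le> t" "t < \<tau> (Suc n)"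
proof -
  obtain N where "t < real N * (1 - sqrt 2 / 2)"
    using reals_Archimedean3[OF gap_pos] by blast
  then have "t < \<tau> N" using \<tau>_ge[of N] by simp
  define M where "M = (LEAST N. t < \<tau> N)"
  have M: "t < \<tau> M" unfolding M_def by (rule LeastI) fact
  then obtain n where n: "M = Suc n" using assms \<tau>_0 by (cases M) auto
  have "\<not> t < \<tau> n" using not_less_Least[of n "\<lambda>N. t < \<tau> N"] n by (simp add: M_def)
  with M n show ?thesis by (intro that[of n]) simp_all
qed

definition T :: "real \<Rightarrow> real ^ 'm" where
  "T t = (let n = LEAST n. t < \<tau> (Suc n) in x n + (t - \<tau> n) *\<^sub>R w n)"

lemma T_leg:
  assumes "\<tau> n \<le> t" "t \<le> \<tau> (Suc n)"
  shows "T t = x n + (t - \<tau> n) *\<^sub>R w n"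
proof -
  have least: "(LEAST i. t < \<tau> (Suc i)) = i" if "\<tau> i \<le> t" "t < \<tau> (Suc i)" for i
  proof (rule Least_equality[of _ i])
    fix j assume "t < \<tau> (Suc j)"
    then have "\<tau> i < \<tau> (Suc j)" using that by simp
    then show "i \<le> j" using \<tau>_strict_mono by (simp add: strict_mono_less)
  qed fact
  show ?thesis
  proof (cases "t < \<tau> (Suc n)")
    case True
    then show ?thesis using least[OF assms(1)] by (simp add: T_def)
  next
    case False
    then have t: "t = \<tau> (Suc n)" using assms by simp
    then have "T t = x (Suc n)"
      using least[of "Suc n"] \<tau>_strict_mono by (simp add: T_def strict_mono_less)
    then show ?thesis using x_Suc[of n] by (simp add: t \<tau>_Suc)
  qed
qed

lemma T_\<tau>: "T (\<tau> n) = x n"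
  using T_leg[of n "\<tau> n"] \<tau>_strict_mono by (simp add: strict_mono_less_eq)

lemma incoming:
  assumes "\<tau> n < t" "t \<le> \<tau> (Suc n)"
  shows "incoming_velocity T t (w n)"
  unfolding incoming_velocity_def
proof (intro exI conjI ballI)
  show "0 < t - \<tau> n" using assms by simp
  fix s assume "s \<in> {0..t - \<tau> n}"
  then show "T (t - s) = T t - s *\<^sub>R w n"
    using assms by (simp add: T_leg[of n] algebra_simps)
qed

lemma outgoing:
  assumes "\<tau> n \<le> t" "t < \<tau> (Suc n)"
  shows "outgoing_velocity T t (w n)"
  unfolding outgoing_velocity_def
proof (intro exI conjI ballI)
  show "0 < \<tau> (Suc n) - t" using assms by simp
  fix s assume "s \<in> {0..\<tau> (Suc n) - t}"
  then show "T (t + s) = T t + s *\<^sub>R w n"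
    using assms by (simp add: T_leg[of n] algebra_simps)
qed

lemma T_avoids:
  assumes "\<tau> n < t" "t < \<tau> (Suc n)"
  shows "T t \<notin> lifted_obstacle S j"
  using leg_avoids[of "t - \<tau> n" n j] assms T_leg[of n t] by (simp add: \<tau>_Suc)

lemma frontier_lifted_subset: "z \<in> frontier (lifted_obstacle S j) \<Longrightarrow> z \<in> lifted_obstacle S j"
  using closed_lifted frontier_subset_closed by blast

lemma x_in_only: "x n \<in> lifted_obstacle S j \<Longrightarrow> j = k n"
  using lifts_disjoint x_in by blast

lemma leg_cases:
  assumes "0 \<le> t"
  obtains (vertex) n where "t = \<tau> n" | (leg) n where "\<tau> n < t" "t < \<tau> (Suc n)"
  using leg_exists[OF assms] by (metis order_le_less)

lemma normal_at_vertex: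
  assumes "outer_unit_normal (lifted_obstacle S j) (x (Suc m)) \<nu>"
  shows "\<nu> = (w (Suc m) - w m) /\<^sub>R norm (w (Suc m) - w m)"
proof -
  have "x (Suc m) \<in> lifted_obstacle S j"
    using assms by (simp add: outer_unit_normal_def frontier_lifted_subset)
  then have "j = k (Suc m)" by (rule x_in_only)
  with assms have "outer_unit_normal (Ob (Suc m)) (x (Suc m)) \<nu>" by simp
  from outer_normal_unique[OF this closed_lifted c_nonzero c_normal]
  show ?thesis by (simp add: c_def)
qed

lemma reflects_at_vertex: "reflects_at S T (\<tau> (Suc m)) (k (Suc m))"
proof -
  obtain \<nu> where \<nu>: "outer_unit_normal (Ob (Suc m)) (x (Suc m)) \<nu>"
    using outer_unit_normal_exists[OF smooth x_frontier] by blast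
  have "incoming_velocity T (\<tau> (Suc m)) (w m)"
    using \<tau>_strict_mono by (intro incoming) (simp_all add: strict_mono_less)
  moreover have "w m \<bullet> \<nu> \<noteq> 0"
    by (rule reflection_from_difference(2)[OF norm_w norm_w w_turns normal_at_vertex[OF \<nu>]])
  ultimately show ?thesis
    using \<nu> unfolding reflects_at_def T_\<tau> by blast
qed

lemma billiard_path_T: "billiard_path S {0..} T"
  unfolding billiard_path_def
proof (intro conjI ballI allI impI)
  fix t :: real and j assume "t \<in> {0..}"
  then have "0 \<le> t" by simp
  then show "T t \<notin> interior (lifted_obstacle S j)"
  proof (cases rule: leg_cases)
    case (vertex n)
    then show ?thesis using x_not_interior[of n] x_in_only[of n j] interior_subset T_\<tau> by fastforce
  next
    case (leg n)
    then show ?thesis using T_avoids interior_subset by blast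
  qed
next
  fix t :: real assume t: "t \<in> {0..}" "\<exists>t'\<in>{0..}. t' < t"
  then have "0 \<le> t" by simp
  then show "\<exists>v. norm v = 1 \<and> incoming_velocity T t v"
  proof (cases rule: leg_cases)
    case (vertex n)
    then obtain m where "n = Suc m" using t \<tau>_0 by (cases n) auto
    then have "\<tau> m < t" "t \<le> \<tau> (Suc m)" using vertex \<tau>_strict_mono by (simp_all add: strict_mono_less)
    then show ?thesis using incoming norm_w by blast
  next
    case (leg n)
    then show ?thesis using incoming[of n t] norm_w[of n] by auto
  qed
next
  fix t :: real assume t: "t \<in> {0..}"
  then obtain n where "\<tau> n \<le> t" "t < \<tau> (Suc n)" using leg_exists by auto
  then show "\<exists>v. norm v = 1 \<and> outgoing_velocity T t v" using outgoing norm_w by blast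
next
  fix t v v' j \<nu>
  assume t: "t \<in> interior {0..}" and vv: "incoming_velocity T t v \<and> outgoing_velocity T t v'"
    and \<nu>: "outer_unit_normal (lifted_obstacle S j) (T t) \<nu>"
  have T: "T t \<in> lifted_obstacle S j"
    using \<nu> by (simp add: outer_unit_normal_def frontier_lifted_subset)
  have "0 < t" using t by simp
  then have "0 \<le> t" by simp
  then show "v' = v - (2 * (v \<bullet> \<nu>)) *\<^sub>R \<nu>"
  proof (cases rule: leg_cases)
    case (vertex n)
    then obtain m where n: "n = Suc m" using \<open>0 < t\<close> \<tau>_0 by (cases n) auto
    then have "incoming_velocity T t (w m)" "outgoing_velocity T t (w (Suc m))"
      using vertex \<tau>_strict_mono by (auto intro!: incoming outgoing simp: strict_mono_less)
    then have "v = w m" "v' = w (Suc m)"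
      using vv incoming_velocity_unique outgoing_velocity_unique by blast+
    moreover have "outer_unit_normal (lifted_obstacle S j) (x (Suc m)) \<nu>"
      using \<nu> vertex n T_\<tau> by simp
    ultimately show ?thesis
      using reflection_from_difference(1)[OF norm_w norm_w w_turns normal_at_vertex] by simp
  next
    case (leg n)
    then show ?thesis using T T_avoids by blast
  qed
next
  fix t v v'
  assume t: "t \<in> interior {0..}" and vv: "incoming_velocity T t v \<and> outgoing_velocity T t v'"
    and off: "\<forall>j. T t \<notin> frontier (lifted_obstacle S j)"
  have "0 \<le> t" using t by simp
  then show "v' = v"
  proof (cases rule: leg_cases)
    case (vertex n)
    then show ?thesis using off x_frontier[of n] T_\<tau> by auto
  next
    case (leg n)
    then have "v = w n" "v' = w n"
      using vv incoming[of n t] outgoing[of n t] incoming_velocity_unique outgoing_velocity_unique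
      by auto
    then show ?thesis by simp
  qed
qed

lemma trajectory_T: "trajectory_of_type S k T"
  unfolding trajectory_of_type_def
proof (intro conjI exI[of _ \<tau>] allI impI billiard_path_T \<tau>_strict_mono \<tau>_0)
  show "k 0 = 0" by (simp add: k_def)
  show "T 0 \<in> frontier (Ob 0)" using T_\<tau>[of 0] x_frontier[of 0] by (simp add: \<tau>_0)
  show "reflects_at S T (\<tau> n) (k n)" if "1 \<le> n" for n
    using reflects_at_vertex[of "n - 1"] that by simp
  show "{t. 0 < t \<and> (\<exists>j. reflects_at S T t j)} = \<tau> ` {1..}"
  proof (intro equalityI subsetI)
    fix t assume "t \<in> {t. 0 < t \<and> (\<exists>j. reflects_at S T t j)}"
    then obtain j where t: "0 < t" "reflects_at S T t j" by auto
    then have "T t \<in> lifted_obstacle S j"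
      by (auto simp: reflects_at_def outer_unit_normal_def frontier_lifted_subset)
    from t(1) have "0 \<le> t" by simp
    then show "t \<in> \<tau> ` {1..}"
    proof (cases rule: leg_cases)
      case (vertex n)
      then have "n \<noteq> 0" using t(1) \<tau>_0 by (cases n) auto
      then show ?thesis using vertex by auto
    next
      case (leg n)
      then show ?thesis using T_avoids \<open>T t \<in> lifted_obstacle S j\<close> by blast
    qed
  next
    fix t assume "t \<in> \<tau> ` {1..}"
    then obtain m where "t = \<tau> (Suc m)" by (auto simp: image_iff dest: Suc_le_D)
    then show "t \<in> {t. 0 < t \<and> (\<exists>j. reflects_at S T t j)}"
      using reflects_at_vertex[of m] strict_mono_less[OF \<tau>_strict_mono, of 0 "Suc m"] \<tau>_0 by auto
  qed
qed

lemma T_near_vertex: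
  assumes "\<tau> n \<le> t" "t \<le> \<tau> (Suc n)"
  shows "norm (T t - x n) = t - \<tau> n"
  using assms by (simp add: T_leg norm_w)

end

section \<open>Trajectory pieces are at least as long as shortest broken lines\<close>

text \<open>
  Unit velocities exist only locally, from each side; Bolzano's bisection principle glues the local
  estimates together.
\<close>

lemma billiard_path_1_lipschitz:
  assumes T: "billiard_path S {0..L} T" and "0 \<le> a" "a \<le> b" "b \<le> L"
  shows "norm (T b - T a) \<le> b - a"
proof -
  have "a \<le> a \<and> b \<le> b \<longrightarrow> norm (T b - T a) \<le> b - a"
    using \<open>a \<le> b\<close>
  proof (induction rule: Bolzano[where P = "\<lambda>s t. a \<le> s \<and> t \<le> b \<longrightarrow> norm (T t - T s) \<le> t - s"])
    case (trans r s t)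
    then show ?case
      using norm_triangle_ineq[of "T t - T s" "T s - T r"] by auto
  next
    case (local x)
    have "\<exists>e>0. \<forall>s. a \<le> s \<and> s \<le> x \<and> x - s < e \<longrightarrow> norm (T x - T s) \<le> x - s"
    proof (cases "a = x")
      case True
      then show ?thesis by (intro exI[of _ 1]) auto
    next
      case False
      then have "x \<in> {0..L}" "\<exists>t'\<in>{0..L}. t' < x" using local assms by (auto intro!: bexI[of _ a])
      then obtain v e where v: "norm v = 1" "e > 0" "\<And>h. h \<in> {0..e} \<Longrightarrow> T (x - h) = T x - h *\<^sub>R v"
        using T unfolding billiard_path_def incoming_velocity_def by meson
      have "norm (T x - T s) \<le> x - s" if "s \<le> x" "x - s < e" for s
        using v(3)[of "x - s"] v(1) that by simp
      then show ?thesis using v(2) by blast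
    qed
    then obtain e1 where e1: "e1 > 0" "\<And>s. a \<le> s \<Longrightarrow> s \<le> x \<Longrightarrow> x - s < e1 \<Longrightarrow> norm (T x - T s) \<le> x - s"
      by blast
    have "\<exists>e>0. \<forall>t. t \<le> b \<and> x \<le> t \<and> t - x < e \<longrightarrow> norm (T t - T x) \<le> t - x"
    proof (cases "b = x")
      case True
      then show ?thesis by (intro exI[of _ 1]) auto
    next
      case False
      then have "x \<in> {0..L}" "\<exists>t'\<in>{0..L}. x < t'" using local assms by (auto intro!: bexI[of _ b])
      then obtain v e where v: "norm v = 1" "e > 0" "\<And>h. h \<in> {0..e} \<Longrightarrow> T (x + h) = T x + h *\<^sub>R v"
        using T unfolding billiard_path_def outgoing_velocity_def by meson
      have "norm (T t - T x) \<le> t - x" if "x \<le> t" "t - x < e" for t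
        using v(3)[of "t - x"] v(1) that by simp
      then show ?thesis using v(2) by blast
    qed
    then obtain e2 where e2: "e2 > 0" "\<And>t. t \<le> b \<Longrightarrow> x \<le> t \<Longrightarrow> t - x < e2 \<Longrightarrow> norm (T t - T x) \<le> t - x"
      by blast
    show ?case
    proof (intro exI[of _ "min e1 e2"] conjI allI impI)
      show "0 < min e1 e2" using e1 e2 by simp
      fix s t assume st: "s \<le> x \<and> x \<le> t \<and> t - s < min e1 e2" "a \<le> s \<and> t \<le> b"
      then have "norm (T t - T x) \<le> t - x" "norm (T x - T s) \<le> x - s"
        by (intro e1(2) e2(2); simp)+
      then show "norm (T t - T s) \<le> t - s"
        using norm_triangle_ineq[of "T t - T x" "T x - T s"] by simp
    qed
  qed
  then show ?thesis by simp
qed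

definition steps :: "(nat \<Rightarrow> int ^ 'm) \<Rightarrow> nat \<Rightarrow> (int ^ 'm) list" where
  "steps k s = map (\<lambda>i. k (Suc i) - k i) [0..<s]"

lemma sum_list_steps: "sum_list (steps k s) = k s - k 0"
  by (induction s) (simp_all add: steps_def)

lemma successively_map_upt:
  "successively P (map f [0..<n]) \<longleftrightarrow> (\<forall>i. Suc i < n \<longrightarrow> P (f i) (f (Suc i)))"
proof (induction n)
  case (Suc n)
  have "successively P (map f [0..<Suc n])
      \<longleftrightarrow> successively P (map f [0..<n]) \<and> (n = 0 \<or> P (f (n - 1)) (f n))"
    by (cases n) (auto simp: successively_append_iff)
  then show ?case
    unfolding Suc.IH by (cases n) (auto simp: less_Suc_eq)
qed simp

context small_billiard
begin

lemma walk_steps: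
  assumes "admissible S {..s} k"
  shows "walk (steps k s)"
proof -
  have adm: "n < s \<Longrightarrow> k (Suc n) \<noteq> k n" "n < s \<Longrightarrow> \<not> between S (k n) j (k (Suc n))"
    "Suc n < s \<Longrightarrow> \<not> between S (k n) (k (Suc n)) (k (Suc (Suc n)))" for n j
    using assms by (auto simp: admissible_def)
  have "free_step (k (Suc n) - k n)" if "n < s" for n
    unfolding free_step_def
  proof (intro conjI allI)
    show "k (Suc n) - k n \<noteq> 0" using adm(1) that by simp
    fix j show "\<not> between S 0 j (k (Suc n) - k n)"
      using adm(2)[OF that, of "k n + j"] by (subst (asm) between_sub) simp
  qed
  moreover have "bends (k (Suc n) - k n) (k (Suc (Suc n)) - k (Suc n))" if "Suc n < s" for n
    using adm(3)[OF that] unfolding bends_def by (subst (asm) between_sub) simp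
  ultimately show ?thesis
    by (auto simp: walk_def steps_def successively_map_upt)
qed

text \<open>
  An inequality between combinatorial and actual length is enough for bounding the deviation of the
  walk later on, and it holds however the piece moves between its reflections: only the speed matters.
\<close>

lemma piece_of_type_bounds:
  assumes "piece_of_type S s k L T"
  shows "min_length (steps k s) \<le> L"
    and "norm (T L - T 0 - lattice_point (sum_list (steps k s))) \<le> 1"
    and "L > 0 \<Longrightarrow> steps k s \<noteq> []"
proof -
  obtain \<tau> where T: "billiard_path S {0..L} T" and k0: "k 0 = 0"
    and ends: "T 0 \<in> frontier (lifted_obstacle S (k 0))" "T L \<in> frontier (lifted_obstacle S (k s))"
    and \<tau>: "strict_mono_on {0..s} \<tau>" "\<tau> 0 = 0" "\<tau> s = L"
    and refl: "\<And>n. n \<in> {1..<s} \<Longrightarrow> reflects_at S T (\<tau> n) (k n)"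
    using assms by (auto simp: piece_of_type_def)
  have le: "\<tau> i \<le> \<tau> j" if "i \<le> j" "j \<le> s" for i j
    using strict_mono_on_leD[OF \<tau>(1), of i j] that by auto
  have "T (\<tau> n) \<in> frontier (lifted_obstacle S (k n))" if n: "n \<le> s" for n
  proof -
    consider "n = 0" | "n = s" | "n \<in> {1..<s}" using n by fastforce
    then show ?thesis
      by cases (use ends \<tau> refl in \<open>auto simp: reflects_at_def outer_unit_normal_def\<close>)
  qed
  then have in_S: "T (\<tau> n) - lattice_point (k n) \<in> S" if "n \<le> s" for n
    using that frontier_subset_closed[OF closed] by (auto simp: frontier_lifted_obstacle_iff)
  show "norm (T L - T 0 - lattice_point (sum_list (steps k s))) \<le> 1"
    using norm_diff_less_1[OF in_S[of s] in_S[of 0]] k0 \<tau> by (simp add: sum_list_steps algebra_simps)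
  show "steps k s \<noteq> []" if "L > 0" using \<tau> that by (cases s) (auto simp: steps_def)
  obtain z where "z \<in> S" using nonempty by auto
  define p where "p i = (if i \<le> s then T (\<tau> i) - lattice_point (k i) else z)" for i
  have "p \<in> UNIV \<rightarrow> S" using in_S \<open>z \<in> S\<close> by (auto simp: p_def)
  then have "min_length (steps k s) \<le> path_length ((!) (steps k s)) p (length (steps k s))"
    by (rule min_length_le)
  also have "\<dots> = (\<Sum>i<s. norm (T (\<tau> (Suc i)) - T (\<tau> i)))"
    unfolding path_length_def
    by (rule sum.cong) (auto simp: steps_def p_def lattice_point_diff)
  also have "\<dots> \<le> (\<Sum>i<s. \<tau> (Suc i) - \<tau> i)"
  proof (rule sum_mono)
    fix i assume "i \<in> {..<s}"
    then show "norm (T (\<tau> (Suc i)) - T (\<tau> i)) \<le> \<tau> (Suc i) - \<tau> i"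
      using le[of 0 i] le[of i "Suc i"] le[of "Suc i" s] \<tau> by (intro billiard_path_1_lipschitz[OF T]) auto
  qed
  also have "\<dots> = L" using \<tau> by (simp add: sum_lessThan_telescope)
  finally show "min_length (steps k s) \<le> L" .
qed

section \<open>Steering a walk along a given vector\<close>

text \<open>
  The error of a walk with respect to motion with constant velocity \<open>u\<close>, measured against the
  combinatorial time \<open>min_length\<close>. It is additive up to \<open>norm u\<close>, whatever the length of the walks.
\<close>

definition deviation :: "real ^ 'm \<Rightarrow> (int ^ 'm) list \<Rightarrow> real ^ 'm" where
  "deviation u ds = lattice_point (sum_list ds) - min_length ds *\<^sub>R u"

lemma deviation_append: "norm (deviation u (A @ B) - (deviation u A + deviation u B)) \<le> norm u"
proof -
  let ?e = "min_length (A @ B) - (min_length A + min_length B)"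
  have "deviation u (A @ B) - (deviation u A + deviation u B) = - (?e *\<^sub>R u)"
    by (simp add: deviation_def lattice_point_add algebra_simps)
  moreover have "\<bar>?e\<bar> \<le> 1"
    using min_length_append_ge[of A B] min_length_append_le[of A B] by linarith
  ultimately show ?thesis by (simp add: mult_left_le_one_le)
qed

lemma norm_lattice_point_sum_list: "norm (lattice_point (sum_list ds)) \<le> (\<Sum>d\<leftarrow>ds. norm (lattice_point d))"
proof (induction ds)
  case (Cons d ds)
  then show ?case using norm_triangle_ineq[of "lattice_point d" "lattice_point (sum_list ds)"]
    by (simp add: lattice_point_add)
qed simp

lemma norm_deviation: "norm (deviation u ds) \<le> (\<Sum>d\<leftarrow>ds. norm (lattice_point d)) * (1 + norm u)"
proof -
  have "norm (deviation u ds) \<le> norm (lattice_point (sum_list ds)) + min_length ds * norm u"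
    unfolding deviation_def by (rule order_trans[OF norm_triangle_ineq4]) (simp add: min_length_nonneg)
  also have "\<dots> \<le> (\<Sum>d\<leftarrow>ds. norm (lattice_point d)) + (\<Sum>d\<leftarrow>ds. norm (lattice_point d)) * norm u"
    by (intro add_mono mult_right_mono norm_lattice_point_sum_list min_length_le_norms) simp
  finally show ?thesis by (simp add: distrib_left)
qed

text \<open>
  Bouncing back and forth between two neighbouring obstacles takes time without any displacement.
\<close>

lemma closed_walk_with_long_length:
  obtains B where "walk B" "B \<noteq> []" "sum_list B = 0" "K \<le> min_length B"
proof -
  obtain N where "K < real N * (1 - sqrt 2 / 2)"
    using reals_Archimedean3[OF gap_pos] by blast
  define f where "f i = (axis undefined ((- 1) ^ i) :: int ^ 'm)" for i :: nat
  define B where "B = map f [0..<2 * Suc N]"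
  have free: "free_step (f i)" for i
    unfolding f_def by (intro free_step_axis) (simp add: minus_one_power_iff)
  have ne: "f i \<noteq> 0" for i using free by (simp add: free_step_def)
  have "bends (f i) (f (Suc i))" for i
  proof (rule bends_if_inner_nonpos[OF ne ne])
    have "lattice_point (f i) \<bullet> lattice_point (f (Suc i)) = of_int ((- 1) ^ i * (- 1) ^ Suc i)"
      unfolding f_def inner_lattice_point_axis by simp
    then show "lattice_point (f i) \<bullet> lattice_point (f (Suc i)) \<le> 0" by (simp add: minus_one_power_iff)
  qed
  then have "walk B" using free by (auto simp: walk_def B_def successively_map_upt simp del: upt_Suc)
  moreover have "sum_list (map f [0..<2 * M]) = 0" for M
  proof (induction M)
    case (Suc M)
    have "f (2 * M) + f (Suc (2 * M)) = 0" by (simp add: f_def vec_eq_iff axis_def)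
    then show ?case using Suc by simp
  qed simp
  then have "sum_list B = 0" unfolding B_def by blast
  moreover have "0 \<notin> set B" unfolding B_def using ne by (metis ex_map_conv)
  then have "real (length B) * (1 - sqrt 2 / 2) \<le> min_length B" by (rule min_length_ge_steps)
  then have "K \<le> min_length B"
  proof -
    have "real N * (1 - sqrt 2 / 2) \<le> real (length B) * (1 - sqrt 2 / 2)"
      using gap_pos by (intro mult_right_mono) (auto simp: B_def)
    with \<open>K < _\<close> \<open>_ \<le> min_length B\<close> show ?thesis by linarith
  qed
  moreover have "B \<noteq> []" by (simp add: B_def)
  ultimately show ?thesis using that by blast
qed

text \<open>
  If \<open>u \<bullet> z > 0\<close>, wasting time without moving decreases the deviation in direction \<open>z\<close>. Otherwise
  \<open>u\<close> can be moved a little against \<open>z\<close> within the rotation set, and a long piece realising the new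
  vector has a deviation that is large against \<open>z\<close>. Its combinatorial length may be smaller than its
  actual length, but as \<open>u \<bullet> z \<le> 0\<close> this only helps.
\<close>

lemma walk_against_direction:
  assumes u: "u \<in> interior (admissible_rotation_set S)" and z: "norm z = 1"
  obtains B where "walk B" "B \<noteq> []" "deviation u B \<bullet> z < - K"
proof (cases "u \<bullet> z > 0")
  case True
  obtain B where B: "walk B" "B \<noteq> []" "sum_list B = 0" "(K + 1) / (u \<bullet> z) \<le> min_length B"
    by (rule closed_walk_with_long_length)
  have "deviation u B \<bullet> z = - (min_length B * (u \<bullet> z))" by (simp add: deviation_def B(3))
  moreover have "K + 1 \<le> min_length B * (u \<bullet> z)" using B(4) True by (simp add: pos_divide_le_eq)
  ultimately have "deviation u B \<bullet> z < - K" by linarith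
  with that B show ?thesis by blast
next
  case False
  obtain e where e: "e > 0" "cball u e \<subseteq> admissible_rotation_set S"
    using u by (auto simp: mem_interior_cball)
  have "u - e *\<^sub>R z \<in> cball u e" using e(1) z by (simp add: dist_norm)
  with e(2) have "u - e *\<^sub>R z \<in> admissible_rotation_set S" by blast
  then obtain x y :: "nat \<Rightarrow> real ^ 'm" and t where
    piece: "\<And>n. \<exists>s k T. admissible S {..s} k \<and> piece_of_type S s k (t n) T \<and> T 0 = x n \<and> T (t n) = y n"
    and t: "filterlim t at_top sequentially"
    and lim: "(\<lambda>n. (y n - x n) /\<^sub>R t n) \<longlonglongrightarrow> u - e *\<^sub>R z"
    unfolding admissible_rotation_set_def by blast
  have "(\<lambda>n. ((y n - x n) /\<^sub>R t n) \<bullet> z) \<longlonglongrightarrow> (u - e *\<^sub>R z) \<bullet> z"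
    using lim by (intro tendsto_intros)
  moreover have "(u - e *\<^sub>R z) \<bullet> z = u \<bullet> z - e" using z by (simp add: inner_diff norm_eq_1)
  ultimately have "\<forall>\<^sub>F n in sequentially. ((y n - x n) /\<^sub>R t n) \<bullet> z < u \<bullet> z - e / 2"
    using e(1) by (intro order_tendstoD(2)[of _ "u \<bullet> z - e"]) auto
  moreover have "\<forall>\<^sub>F n in sequentially. 0 < t n"
    using t unfolding filterlim_at_top_dense by blast
  \<comment> \<open>The gain \<open>t n * e / 2\<close> has to exceed \<open>K\<close> by more than the error \<open>1\<close> of the displacement.\<close>
  moreover have "\<forall>\<^sub>F n in sequentially. 2 * (K + 2) / e \<le> t n"
    using t unfolding filterlim_at_top by blast
  ultimately have "\<forall>\<^sub>F n in sequentially.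
      ((y n - x n) /\<^sub>R t n) \<bullet> z < u \<bullet> z - e / 2 \<and> 0 < t n \<and> 2 * (K + 2) / e \<le> t n"
    by eventually_elim auto
  then obtain n where n: "((y n - x n) /\<^sub>R t n) \<bullet> z < u \<bullet> z - e / 2" "0 < t n" "2 * (K + 2) / e \<le> t n"
    by (auto dest: eventually_happens)
  obtain s k T where T: "admissible S {..s} k" "piece_of_type S s k (t n) T" "T 0 = x n" "T (t n) = y n"
    using piece by blast
  let ?B = "steps k s"
  note bounds = piece_of_type_bounds[OF T(2), unfolded T(3,4)]
  have "(y n - x n) \<bullet> z = t n * (((y n - x n) /\<^sub>R t n) \<bullet> z)" using n(2) by simp
  also have "\<dots> \<le> t n * (u \<bullet> z - e / 2)" using n by (intro mult_left_mono) auto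
  finally have 1: "(y n - x n) \<bullet> z \<le> t n * (u \<bullet> z) - t n * (e / 2)" by (simp add: right_diff_distrib)
  have 2: "K + 2 \<le> t n * (e / 2)" using n(3) e(1) by (simp add: field_simps)
  have 3: "- ((y n - x n - lattice_point (sum_list ?B)) \<bullet> z) \<le> 1"
    using Cauchy_Schwarz_ineq2[of "y n - x n - lattice_point (sum_list ?B)" z] bounds(2) z by simp
  have 4: "t n * (u \<bullet> z) \<le> min_length ?B * (u \<bullet> z)"
    using bounds(1) False by (intro mult_right_mono_neg) auto
  have "deviation u ?B \<bullet> z = (y n - x n) \<bullet> z
      - (y n - x n - lattice_point (sum_list ?B)) \<bullet> z - min_length ?B * (u \<bullet> z)"
    by (simp add: deviation_def inner_diff)
  with 1 2 3 4 have "deviation u ?B \<bullet> z < - K" by linarith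
  with that[OF walk_steps[OF T(1)] bounds(3)[OF n(2)]] show ?thesis by blast
qed

lemma finitely_many_steering_walks:
  assumes u: "u \<in> interior (admissible_rotation_set S)"
  obtains F where "finite F" "\<And>B. B \<in> F \<Longrightarrow> walk B \<and> B \<noteq> []"
    "\<And>z. norm z = 1 \<Longrightarrow> \<exists>B\<in>F. deviation u B \<bullet> z < - K"
proof -
  let ?W = "{B. walk B \<and> B \<noteq> []}"
  have "compact (sphere (0 :: real ^ 'm) 1)" by simp
  moreover have "open {z. deviation u B \<bullet> z < - K}" for B
    by (intro open_Collect_less continuous_intros)
  moreover have "sphere 0 1 \<subseteq> (\<Union>B\<in>?W. {z. deviation u B \<bullet> z < - K})"
  proof
    fix z :: "real ^ 'm" assume "z \<in> sphere 0 1"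
    then have "norm z = 1" by simp
    from walk_against_direction[OF u this, of K] show "z \<in> (\<Union>B\<in>?W. {z. deviation u B \<bullet> z < - K})"
      by blast
  qed
  ultimately obtain F where F: "F \<subseteq> ?W" "finite F" "sphere 0 1 \<subseteq> (\<Union>B\<in>F. {z. deviation u B \<bullet> z < - K})"
    by (rule compactE_image)
  show ?thesis
  proof (rule that[OF F(2)])
    show "walk B \<and> B \<noteq> []" if "B \<in> F" for B using F(1) that by blast
    show "\<exists>B\<in>F. deviation u B \<bullet> z < - K" if "norm z = 1" for z
    proof -
      have "z \<in> sphere 0 1" using that by simp
      with F(3) show ?thesis by blast
    qed
  qed
qed

end

text \<open>
  Corrections of bounded size that point sufficiently towards the origin keep a vector in a fixed
  ball: far from the origin they shorten it, and near the origin they do no harm.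
\<close>

lemma norm_add_le_if_inner_le:
  fixes E v :: "'a::real_inner"
  assumes "norm v \<le> M" "E \<bullet> v \<le> - norm E" "norm E \<le> M\<^sup>2 + M"
  shows "norm (E + v) \<le> M\<^sup>2 + M"
proof (cases "M\<^sup>2 \<le> 2 * norm E")
  case True
  have "(norm (E + v))\<^sup>2 = (norm E)\<^sup>2 + 2 * (E \<bullet> v) + (norm v)\<^sup>2"
    by (simp add: power2_norm_eq_inner inner_add inner_commute)
  moreover have "(norm v)\<^sup>2 \<le> M\<^sup>2" using assms(1) by (intro power_mono) auto
  ultimately have "(norm (E + v))\<^sup>2 \<le> (norm E)\<^sup>2" using assms(2) True by linarith
  then have "norm (E + v) \<le> norm E" by (rule power2_le_imp_le) simp
  with assms(3) show ?thesis by linarith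
next
  case False
  then show ?thesis using norm_triangle_ineq[of E v] assms(1) zero_le_power2[of M] by linarith
qed

text \<open>
  Dependent choice for lists. The numbers \<open>c i\<close> mark where the blocks begin, so that the invariant is
  known at these positions and the blocks themselves are controlled by \<open>P\<close>.
\<close>

lemma infinite_extension:
  assumes "Q []" and ext: "\<And>A. Q A \<Longrightarrow> \<exists>X. X \<noteq> [] \<and> P X \<and> Q (A @ X)"
  obtains d :: "nat \<Rightarrow> 'a" and c where "strict_mono c" "c 0 = 0"
    "\<And>i. Q (map d [0..<c i])" "\<And>i. P (map d [c i..<c (Suc i)])"
proof -
  obtain f where f: "\<And>A. Q A \<Longrightarrow> f A \<noteq> [] \<and> P (f A) \<and> Q (A @ f A)" using ext by metis
  define A where "A = rec_nat [] (\<lambda>_ A. A @ f A)"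
  have A: "A 0 = []" "\<And>i. A (Suc i) = A i @ f (A i)" by (simp_all add: A_def)
  have Q: "Q (A i)" for i by (induction i) (use f assms(1) in \<open>auto simp: A\<close>)
  define c where "c i = length (A i)" for i
  have "strict_mono c"
    unfolding strict_mono_Suc_iff c_def using f Q by (simp add: A)
  have prefix: "\<exists>Z. A j = A i @ Z" if "i \<le> j" for i j
    using that by (induction j rule: dec_induct) (auto simp: A)
  define d where "d j = A (Suc j) ! j" for j
  have d: "map d [0..<c i] = A i" for i
  proof (rule nth_equalityI)
    fix j assume "j < length (map d [0..<c i])"
    then have j: "j < length (A i)" by (simp add: c_def)
    have j': "j < length (A (Suc j))"
      using strict_mono_imp_increasing[OF \<open>strict_mono c\<close>, of "Suc j"] by (simp add: c_def)
    obtain Y Z where "A (max i (Suc j)) = A i @ Y" "A (max i (Suc j)) = A (Suc j) @ Z"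
      using prefix[of i "max i (Suc j)"] prefix[of "Suc j" "max i (Suc j)"] by auto
    then have "A i ! j = A (Suc j) ! j" using j j' by (metis nth_append)
    then show "map d [0..<c i] ! j = A i ! j" using j by (simp add: d_def c_def)
  qed (simp add: c_def)
  have "map d [c i..<c (Suc i)] = f (A i)" for i
  proof -
    have "map d [c i..<c (Suc i)] = drop (c i) (map d [0..<c (Suc i)])" by (simp add: drop_map)
    also have "\<dots> = f (A i)" unfolding d by (simp add: A c_def)
    finally show ?thesis .
  qed
  then show ?thesis
    using that[OF \<open>strict_mono c\<close>, of d] f Q by (simp add: c_def A d[unfolded c_def])
qed

context small_billiard
begin

lemma walk_connect:
  assumes "walk A" "walk B" "B \<noteq> []"
  obtains c where "walk (A @ c @ B)" "(\<Sum>d\<leftarrow>c. norm (lattice_point d)) \<le> 1"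
proof (cases "A = []")
  case True
  then show ?thesis using that[of "[]"] assms by simp
next
  case False
  have "free_step (last A)" "free_step (hd B)"
    using assms False by (simp_all add: walk_def)
  then obtain c where c: "length c \<le> 1" "\<And>a. a \<in> set c \<Longrightarrow> free_step a \<and> norm (lattice_point a) = 1"
    "successively bends (last A # c @ [hd B])"
    using connect by blast
  have "walk (A @ c @ B)"
    using assms False c(1-3) unfolding walk_def
    by (cases c) (auto simp: successively_append_iff successively_Cons)
  moreover have "(\<Sum>d\<leftarrow>c. norm (lattice_point d)) \<le> 1"
    using c(1,2) by (cases c) auto
  ultimately show ?thesis using that by blast
qed

text \<open>
  A greedy choice. The next block is taken from a fixed finite family so that it counteracts the
  current deviation by more than the bounded cost of joining it on. The deviation refers to the walk
  made so far, so the choice is possible although travel times are only approximately additive and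
  their errors could add up over infinitely many blocks.
\<close>

lemma steered_walk:
  assumes u: "u \<in> interior (admissible_rotation_set S)"
  obtains d R N where "\<And>n. free_step (d n)" "\<And>n. bends (d n) (d (Suc n))"
    "\<And>n. norm (deviation u (map d [0..<n])) \<le> R" "\<And>n. norm (lattice_point (d n)) \<le> N"
proof -
  \<comment> \<open>\<open>C\<close> bounds the deviation that joining causes: twice the defect \<open>norm u\<close> of additivity, and the
     deviation of a connecting walk of length at most \<open>1\<close>.\<close>
  define C where "C = 1 + 3 * norm u"
  obtain F where F: "finite F" "\<And>B. B \<in> F \<Longrightarrow> walk B \<and> B \<noteq> []"
    "\<And>z. norm z = 1 \<Longrightarrow> \<exists>B\<in>F. deviation u B \<bullet> z < - (C + 1)"
    using finitely_many_steering_walks[OF u] by blast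
  define size where "size ds = (\<Sum>d\<leftarrow>ds. norm (lattice_point d))" for ds :: "(int ^ 'm) list"
  have size_append: "size (A @ B) = size A + size B" and size_nonneg: "0 \<le> size A" for A B
    by (auto simp: size_def intro!: sum_list_nonneg)
  have "\<exists>M. \<forall>B\<in>F. norm (deviation u B) \<le> M" "\<exists>M. \<forall>B\<in>F. size B \<le> M"
    using F(1) by (meson finite_imageI bdd_above_finite bdd_above.unfold image_eqI)+
  then obtain M0 M1 where M0: "\<And>B. B \<in> F \<Longrightarrow> norm (deviation u B) \<le> M0"
    and M1: "\<And>B. B \<in> F \<Longrightarrow> size B \<le> M1" by blast
  define M where "M = M0 + C"
  define Q where "Q A \<longleftrightarrow> walk A \<and> norm (deviation u A) \<le> M\<^sup>2 + M" for A
  have extend: "\<exists>X. X \<noteq> [] \<and> size X \<le> M1 + 1 \<and> Q (A @ X)" if A: "Q A" for A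
  proof -
    let ?E = "deviation u A"
    \<comment> \<open>When the deviation vanishes, any block will do; \<open>e0\<close> selects one.\<close>
    obtain e0 :: "real ^ 'm" where "norm e0 = 1" using vector_choose_size[of 1] by auto
    define z where "z = (if ?E = 0 then e0 else sgn ?E)"
    have z: "norm z = 1" "?E = norm ?E *\<^sub>R z"
      using \<open>norm e0 = 1\<close> by (auto simp: z_def norm_sgn sgn_div_norm)
    obtain B where B: "B \<in> F" "deviation u B \<bullet> z < - (C + 1)" using F(3)[OF z(1)] by blast
    obtain c where c: "walk (A @ c @ B)" "size c \<le> 1"
      using walk_connect[of A B] A F(2)[OF B(1)] unfolding Q_def size_def by blast
    define v where "v = deviation u (A @ c @ B) - ?E"
    have err: "norm (v - deviation u B) \<le> C"
    proof -
      have "v - deviation u B = (deviation u (A @ c @ B) - (?E + deviation u (c @ B)))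
          + (deviation u (c @ B) - (deviation u c + deviation u B)) + deviation u c"
        by (simp add: v_def)
      also have "norm \<dots> \<le> norm u + norm u + (1 + norm u)"
      proof (intro norm_triangle_le add_mono deviation_append)
        have "norm (deviation u c) \<le> size c * (1 + norm u)"
          unfolding size_def by (rule norm_deviation)
        also have "\<dots> \<le> 1 * (1 + norm u)" using c(2) by (intro mult_right_mono) auto
        finally show "norm (deviation u c) \<le> 1 + norm u" by simp
      qed
      finally show ?thesis by (simp add: C_def)
    qed
    have "norm v \<le> M"
      using norm_triangle_ineq[of "deviation u B" "v - deviation u B"] err M0[OF B(1)] by (simp add: M_def)
    moreover have "?E \<bullet> v \<le> - norm ?E"
    proof -
      have "z \<bullet> (v - deviation u B) \<le> C"
        using norm_cauchy_schwarz[of z "v - deviation u B"] err z(1) by simp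
      then have "z \<bullet> v \<le> - 1" using B(2) by (simp add: inner_diff inner_commute)
      then have "norm ?E * (z \<bullet> v) \<le> norm ?E * (- 1)" by (rule mult_left_mono) simp
      moreover have "?E \<bullet> v = norm ?E * (z \<bullet> v)" by (subst z(2)) simp
      ultimately show ?thesis by simp
    qed
    ultimately have "norm (?E + v) \<le> M\<^sup>2 + M"
      using A unfolding Q_def by (intro norm_add_le_if_inner_le) auto
    then have "Q (A @ c @ B)" using c(1) by (simp add: Q_def v_def)
    moreover have "size (c @ B) \<le> M1 + 1" using c(2) M1[OF B(1)] by (simp add: size_append)
    moreover have "c @ B \<noteq> []" using F(2)[OF B(1)] by simp
    ultimately show ?thesis by blast
  qed
  have "Q []"
  proof -
    have "\<exists>B. B \<in> F" using F(3)[of "axis undefined 1"] by auto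
    then have "0 \<le> M" using M0 norm_ge_zero order_trans unfolding M_def C_def
      by (metis add_nonneg_nonneg mult_nonneg_nonneg zero_le_numeral zero_le_one)
    moreover have "deviation u [] = 0" using norm_deviation[of u "[]"] by simp
    ultimately show ?thesis by (simp add: Q_def walk_def)
  qed
  then obtain d c where c: "strict_mono c" "c 0 = 0" and Q: "\<And>i. Q (map d [0..<c i])"
    and size: "\<And>i. size (map d [c i..<c (Suc i)]) \<le> M1 + 1"
    using infinite_extension[of Q "\<lambda>X. size X \<le> M1 + 1", OF _ extend] by metis
  have c_ge: "n \<le> c n" for n by (rule strict_mono_imp_increasing[OF c(1)])
  have walk: "walk (map d [0..<n])" for n
  proof -
    have "map d [0..<c n] = map d [0..<n] @ map d [n..<c n]"
      using upt_add_eq_append[of 0 n "c n - n"] c_ge[of n] by simp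
    then show ?thesis using Q[of n] by (auto simp: Q_def walk_def successively_append_iff)
  qed
  have block: "\<exists>i. c i \<le> n \<and> n < c (Suc i)" for n
  proof -
    define i where "i = (LEAST i. n < c (Suc i))"
    have "n < c (Suc n)" using c_ge[of "Suc n"] by simp
    then have "n < c (Suc i)" unfolding i_def by (rule LeastI)
    moreover have "c i \<le> n"
    proof (cases i)
      case (Suc j)
      then show ?thesis using not_less_Least[of j "\<lambda>i. n < c (Suc i)"] by (simp add: i_def)
    qed (simp add: c(2))
    ultimately show ?thesis by blast
  qed
  show ?thesis
  proof (rule that[of d "M\<^sup>2 + M + norm u + (M1 + 1) * (1 + norm u)" "M1 + 1"])
    fix n
    show "free_step (d n)" using walk[of "Suc n"] by (simp add: walk_def)
    show "bends (d n) (d (Suc n))" using walk[of "Suc (Suc n)"]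
      by (simp add: walk_def successively_map_upt del: upt_Suc)
    obtain i where i: "c i \<le> n" "n < c (Suc i)" using block by blast
    let ?Y = "map d [c i..<n]"
    have split: "map d [c i..<c (Suc i)] = ?Y @ d n # map d [Suc n..<c (Suc i)]"
      using upt_add_eq_append[of "c i" n "c (Suc i) - n"] i by (simp add: upt_conv_Cons)
    have sizes: "size ?Y + norm (lattice_point (d n)) + size (map d [Suc n..<c (Suc i)]) \<le> M1 + 1"
      using size[of i] unfolding split size_append by (simp add: size_def)
    then show "norm (lattice_point (d n)) \<le> M1 + 1"
      using size_nonneg[of ?Y] size_nonneg[of "map d [Suc n..<c (Suc i)]"] by linarith
    have "size ?Y \<le> M1 + 1" using sizes size_nonneg[of "map d [Suc n..<c (Suc i)]"] norm_ge_zero[of "lattice_point (d n)"] by linarith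
    then have "size ?Y * (1 + norm u) \<le> (M1 + 1) * (1 + norm u)" by (intro mult_right_mono) auto
    then have 1: "norm (deviation u ?Y) \<le> (M1 + 1) * (1 + norm u)"
      using norm_deviation[of u ?Y] unfolding size_def by linarith
    let ?A = "map d [0..<c i]"
    have 2: "norm (deviation u ?A) \<le> M\<^sup>2 + M" using Q by (simp add: Q_def)
    have "map d [0..<n] = ?A @ ?Y" using upt_add_eq_append[of 0 "c i" "n - c i"] i by simp
    moreover have "norm (deviation u (?A @ ?Y))
        \<le> norm (deviation u (?A @ ?Y) - (deviation u ?A + deviation u ?Y)) + (norm (deviation u ?A) + norm (deviation u ?Y))"
      using norm_triangle_ineq[of "deviation u (?A @ ?Y) - (deviation u ?A + deviation u ?Y)" "deviation u ?A + deviation u ?Y"]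
        norm_triangle_ineq[of "deviation u ?A" "deviation u ?Y"] by simp
    ultimately show "norm (deviation u (map d [0..<n])) \<le> M\<^sup>2 + M + norm u + (M1 + 1) * (1 + norm u)"
      using deviation_append[of u ?A ?Y] 1 2 by simp
  qed
qed

theorem trajectory_with_rotation_vector:
  assumes u: "u \<in> interior (admissible_rotation_set S)"
  shows "\<exists>k T. admissible S UNIV k \<and> trajectory_of_type S k T \<and> has_rotation_vector T u"
proof -
  obtain d R N where d: "\<And>n. free_step (d n)" "\<And>n. bends (d n) (d (Suc n))"
    and R: "\<And>n. norm (deviation u (map d [0..<n])) \<le> R" and N: "\<And>n. norm (lattice_point (d n)) \<le> N"
    using steered_walk[OF u] by blast
  obtain p where p: "prefix_minimal d p" using exists_prefix_minimal by blast
  interpret orbit: minimal_broken_line S d p by unfold_locales (fact d p)+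
  let ?T = orbit.T and ?x = orbit.x and ?\<tau> = orbit.\<tau>
  have leg: "norm (?x (Suc n) - ?x n) \<le> N + 1" for n
    using norm_triangle_ineq[of "p (Suc n) - p n" "lattice_point (d n)"] N[of n]
      norm_diff_less_1[OF orbit.p_in orbit.p_in, of "Suc n" n] unfolding orbit.leg_eq by linarith
  have vertex: "norm (?x n - ?x 0 - ?\<tau> n *\<^sub>R u) \<le> 1 + R + norm u" for n
  proof -
    let ?l = "min_length (map d [0..<n])"
    have "orbit.k n = sum_list (map d [0..<n])"
      by (simp add: orbit.k_def interv_sum_list_conv_sum_set_nat atLeast0LessThan)
    then have "?x n - ?x 0 - ?\<tau> n *\<^sub>R u = (p n - p 0) + deviation u (map d [0..<n]) + (?l - ?\<tau> n) *\<^sub>R u"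
      by (simp add: orbit.x_def orbit.k_def deviation_def algebra_simps)
    also have "norm \<dots> \<le> 1 + R + norm u"
    proof (intro norm_triangle_le add_mono R)
      show "norm (p n - p 0) \<le> 1" using norm_diff_less_1[OF orbit.p_in orbit.p_in] by (rule less_imp_le)
      have "\<bar>?l - ?\<tau> n\<bar> \<le> 1"
        using prefix_minimal_length[OF p, of n] unfolding orbit.\<tau>_def
        by (simp add: abs_minus_commute)
      then have "\<bar>?l - ?\<tau> n\<bar> * norm u \<le> 1 * norm u" by (rule mult_right_mono) simp
      then show "norm ((?l - ?\<tau> n) *\<^sub>R u) \<le> norm u" by simp
    qed
    finally show ?thesis .
  qed
  define D where "D = (N + 1) + (1 + R + norm u) + (N + 1) * norm u"
  have bounded: "norm (?T t - ?T 0 - t *\<^sub>R u) \<le> D" if t: "0 \<le> t" for t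
  proof -
    obtain n where n: "?\<tau> n \<le> t" "t < ?\<tau> (Suc n)" using orbit.leg_exists[OF t] by blast
    have late: "t - ?\<tau> n \<le> N + 1" using n(2) leg[of n] orbit.\<tau>_Suc[of n] by linarith
    have "?T t - ?T 0 - t *\<^sub>R u
        = (?T t - ?x n) + (?x n - ?x 0 - ?\<tau> n *\<^sub>R u) + (?\<tau> n - t) *\<^sub>R u"
      using orbit.T_\<tau>[of 0] by (simp add: orbit.\<tau>_0 algebra_simps)
    also have "norm \<dots> \<le> D"
      unfolding D_def
    proof (intro norm_triangle_le add_mono vertex)
      show "norm (?T t - ?x n) \<le> N + 1" using orbit.T_near_vertex[of n t] n late by simp
      have "\<bar>?\<tau> n - t\<bar> * norm u \<le> (N + 1) * norm u" using n late by (intro mult_right_mono) auto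
      then show "norm ((?\<tau> n - t) *\<^sub>R u) \<le> (N + 1) * norm u" by simp
    qed
    finally show ?thesis .
  qed
  have "((\<lambda>t. (?T t - ?T 0) /\<^sub>R t - u) \<longlongrightarrow> 0) at_top"
  proof (rule Lim_null_comparison)
    show "\<forall>\<^sub>F t in at_top. norm ((?T t - ?T 0) /\<^sub>R t - u) \<le> D / t"
      using eventually_gt_at_top[of 0]
    proof eventually_elim
      fix t :: real assume t: "0 < t"
      then have "(?T t - ?T 0) /\<^sub>R t - u = (?T t - ?T 0 - t *\<^sub>R u) /\<^sub>R t"
        by (simp add: scaleR_diff_right)
      also have "norm \<dots> = norm (?T t - ?T 0 - t *\<^sub>R u) / t" using t by (simp add: divide_inverse)
      also have "\<dots> \<le> D / t" using bounded[of t] t by (intro divide_right_mono) auto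
      finally show "norm ((?T t - ?T 0) /\<^sub>R t - u) \<le> D / t" .
    qed
    show "((\<lambda>t. D / t) \<longlongrightarrow> 0) at_top"
      by (rule tendsto_divide_0[OF tendsto_const filterlim_at_top_imp_at_infinity[OF filterlim_ident]])
  qed
  then have "has_rotation_vector ?T u"
    unfolding has_rotation_vector_def by (rule LIM_zero_cancel)
  then show ?thesis using orbit.admissible_k orbit.trajectory_T by blast
qed

end

theorem corollary3p8:
  fixes S :: "(real ^ 'm::finite) set" and u :: "real ^ 'm"
  assumes "CARD('m) \<ge> 2"
    and "obstacle S"
    and "small_obstacle S"
    and "u \<in> interior (admissible_rotation_set S)"
  shows "\<exists>k T. admissible S UNIV k \<and> trajectory_of_type S k T \<and> has_rotation_vector T u"
proof -
  interpret small_billiard S by unfold_locales fact+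
  show ?thesis by (rule trajectory_with_rotation_vector) fact
qed

end
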